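(* Let $F\in\mathcal{E}^m$, let $A_1,\dots,A_d$ be an orthonormal basis of a linear subspace $\mathcal{L}\subseteq\mathbb{S}^m$, and let $L(\theta)=\sum_{i=1}^d\theta_iA_i$. Let $X_1,X_2,\dots$ be an i.i.d. sequence from a mean zero distribution on $\mathbb{R}^m$ with positive definite covariance matrix $\Sigma_0$, and suppose $\mathbb{E}(S_n)=\Sigma_0\in M_F(\mathcal{L})$. Then the Bregman estimator $\widehat\theta_n$ in $M_F(\mathcal{L})$ is a consistent estimator of $\theta_0$ (that is, $\widehat\theta_n\to\theta_0$ in probability as $n\to\infty$), where $\theta_0\in\mathbb{R}^d$ is the unique point such that $\nabla F^*(L(\theta_0))=\Sigma_0$.
   Context: $\mathbb{S}^m$ is the space of real symmetric $m\times m$ matrices with inner product $\langle A,B\rangle=\mathrm{tr}(AB)$ and Frobenius norm; $\mathbb{S}^m_+$ and $\overline{\mathbb{S}}^m_+$ are the subsets of positive definite and positive semidefinite matrices. $\mathcal{E}^m$ is the set of functions $F:\mathbb{S}^m\to\mathbb{R}\cup\{+\infty\}$ such that (i) $F$ is convex, not identically $+\infty$, and lower semicontinuous; (ii) $\mathbb{S}^m_+\subseteq\mathrm{dom}(F)\subseteq\overline{\mathbb{S}}^m_+$, where $\mathrm{dom}(F)=\{F<+\infty\}$; (iii) $F$ is strictly convex and continuously differentiable on $\mathbb{S}^m_+$. Gradients are with respect to $\langle\cdot,\cdot\rangle$. $\mathbb{L}^m_+:=\nabla F(\mathbb{S}^m_+)$. The conjugate is $F^*(L)=\sup_{\Sigma\in\mathbb{S}^m}\{\langle\Sigma,L\rangle-F(\Sigma)\}$;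 $\nabla F:\mathbb{S}^m_+\to\mathbb{L}^m_+$ and $\nabla F^*:\mathbb{L}^m_+\to\mathbb{S}^m_+$ are inverse to each other. $M_F(\mathcal{L})=\{\Sigma\in\mathbb{S}^m_+:\nabla F(\Sigma)\in\mathcal{L}\}$. $\Theta_+=\{\theta\in\mathbb{R}^d:L(\theta)\in\mathbb{L}^m_+\}$. The sample covariance matrix is $S_n=\frac1n\sum_{i=1}^nX_iX_i^\top$. The Bregman estimator $\widehat\theta_n$ is the (unique, if it exists) minimizer over $\theta\in\Theta_+$ of $M_n(\theta)=F^*(L(\theta))-\langle L(\theta),S_n\rangle$; on the event that no minimizer exists, $\widehat\theta_n$ is assigned an arbitrary value. *)

theory Defs
  imports "HOL-Probability.Probability"
begin

text \<open>
  The space of symmetric matrices is the subspace \<open>Sym\<close> of \<^typ>\<open>real^'m^'m\<close>. On it the library's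
  inner product, norm and topology are the trace inner product, the Frobenius norm and the Frobenius
  topology. Functions on \<open>Sym\<close> are represented by functions on all matrices of which only the values
  on \<open>Sym\<close> are ever used; limits and derivatives are taken within \<open>Sym\<close>.
\<close>

definition Sym :: "(real^'m^'m) set" where
  "Sym = {A. transpose A = A}"

definition SymPD :: "(real^'m^'m) set" where
  "SymPD = {A \<in> Sym. \<forall>x. x \<noteq> 0 \<longrightarrow> x \<bullet> (A *v x) > 0}"

definition SymPSD :: "(real^'m^'m) set" where
  "SymPSD = {A \<in> Sym. \<forall>x. x \<bullet> (A *v x) \<ge> 0}"

definition tr_inner :: "real^'m^'m \<Rightarrow> real^'m^'m \<Rightarrow> real" where
  "tr_inner A B = trace (A ** B)"

lemma tr_inner_eq_inner: "A \<in> Sym \<Longrightarrow> tr_inner A B = A \<bullet> B"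
proof -
  assume "A \<in> Sym"
  then have "A $ i $ k = A $ k $ i" for i k
    unfolding Sym_def transpose_def by (auto simp: vec_eq_iff)
  then have "tr_inner A B = (\<Sum>i\<in>UNIV. \<Sum>k\<in>UNIV. A $ k $ i * B $ k $ i)"
    unfolding tr_inner_def trace_def matrix_matrix_mult_def by simp
  also have "\<dots> = A \<bullet> B"
    by (subst sum.swap) (simp add: inner_vec_def)
  finally show ?thesis .
qed

definition ereal_convex_on :: "'a::real_vector set \<Rightarrow> ('a \<Rightarrow> ereal) \<Rightarrow> bool" where
  "ereal_convex_on S f \<longleftrightarrow> convex S \<and>
     (\<forall>x\<in>S. \<forall>y\<in>S. \<forall>t. 0 < t \<and> t < 1 \<longrightarrow>
        f ((1 - t) *\<^sub>R x + t *\<^sub>R y) \<le> ereal (1 - t) * f x + ereal t * f y)"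

definition ereal_strictly_convex_on :: "'a::real_vector set \<Rightarrow> ('a \<Rightarrow> ereal) \<Rightarrow> bool" where
  "ereal_strictly_convex_on S f \<longleftrightarrow> convex S \<and>
     (\<forall>x\<in>S. \<forall>y\<in>S. \<forall>t. x \<noteq> y \<and> 0 < t \<and> t < 1 \<longrightarrow>
        f ((1 - t) *\<^sub>R x + t *\<^sub>R y) < ereal (1 - t) * f x + ereal t * f y)"

definition lsc_on :: "'a::topological_space set \<Rightarrow> ('a \<Rightarrow> ereal) \<Rightarrow> bool" where
  "lsc_on S f \<longleftrightarrow> (\<forall>x\<in>S. f x \<le> Liminf (at x within S) f)"

text \<open>
  \<open>has_sym_gradient f G X\<close>: the extended-real function \<open>f\<close> on \<open>Sym\<close> is finite near \<open>X\<close> and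
  differentiable at \<open>X\<close> with gradient \<open>G\<close> with respect to \<^const>\<open>tr_inner\<close>. Finiteness is required
  explicitly because \<^const>\<open>real_of_ereal\<close> sends infinite values to 0.
\<close>
definition has_sym_gradient ::
    "(real^'m^'m \<Rightarrow> ereal) \<Rightarrow> real^'m^'m \<Rightarrow> real^'m^'m \<Rightarrow> bool" where
  "has_sym_gradient f G X \<longleftrightarrow> X \<in> Sym \<and> G \<in> Sym \<and>
     \<bar>f X\<bar> \<noteq> \<infinity> \<and> (\<forall>\<^sub>F Y in at X within Sym. \<bar>f Y\<bar> \<noteq> \<infinity>) \<and>
     ((\<lambda>Y. real_of_ereal (f Y)) has_derivative (\<lambda>H. tr_inner G H)) (at X within Sym)"

text \<open>The gradient is unique where it exists, since it is required to be symmetric.\<close>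
definition sym_grad :: "(real^'m^'m \<Rightarrow> ereal) \<Rightarrow> real^'m^'m \<Rightarrow> real^'m^'m" where
  "sym_grad f X = (THE G. has_sym_gradient f G X)"

definition edom :: "(real^'m^'m \<Rightarrow> ereal) \<Rightarrow> (real^'m^'m) set" where
  "edom F = {X \<in> Sym. F X < \<infinity>}"

definition bregman_class :: "(real^'m^'m \<Rightarrow> ereal) set" where
  "bregman_class = {F.
     (\<forall>X\<in>Sym. F X \<noteq> -\<infinity>) \<and>
     ereal_convex_on Sym F \<and> (\<exists>X\<in>Sym. F X \<noteq> \<infinity>) \<and> lsc_on Sym F \<and>
     SymPD \<subseteq> edom F \<and> edom F \<subseteq> SymPSD \<and>
     ereal_strictly_convex_on SymPD F \<and>
     (\<forall>X\<in>SymPD. \<exists>G. has_sym_gradient F G X) \<and> continuous_on SymPD (sym_grad F)}"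

definition conjugate :: "(real^'m^'m \<Rightarrow> ereal) \<Rightarrow> real^'m^'m \<Rightarrow> ereal" where
  "conjugate F L = (SUP X\<in>Sym. ereal (tr_inner X L) - F X)"

definition Lplus :: "(real^'m^'m \<Rightarrow> ereal) \<Rightarrow> (real^'m^'m) set" where
  "Lplus F = sym_grad F ` SymPD"

definition bregman_model :: "(real^'m^'m \<Rightarrow> ereal) \<Rightarrow> (real^'m^'m) set \<Rightarrow> (real^'m^'m) set" where
  "bregman_model F \<L> = {X \<in> SymPD. sym_grad F X \<in> \<L>}"

definition orthonormal_basis :: "('d::finite \<Rightarrow> real^'m^'m) \<Rightarrow> (real^'m^'m) set \<Rightarrow> bool" where
  "orthonormal_basis A \<L> \<longleftrightarrow>
     (\<forall>i j. tr_inner (A i) (A j) = (if i = j then 1 else 0)) \<and> range A \<subseteq> \<L> \<and> span (range A) = \<L>"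

definition Lmap :: "('d::finite \<Rightarrow> real^'m^'m) \<Rightarrow> real^'d \<Rightarrow> real^'m^'m" where
  "Lmap A \<theta> = (\<Sum>i\<in>UNIV. (\<theta> $ i) *\<^sub>R A i)"

definition Theta_plus ::
    "(real^'m^'m \<Rightarrow> ereal) \<Rightarrow> ('d::finite \<Rightarrow> real^'m^'m) \<Rightarrow> (real^'d) set" where
  "Theta_plus F A = {\<theta>. Lmap A \<theta> \<in> Lplus F}"

definition bregman_loss ::
    "(real^'m^'m \<Rightarrow> ereal) \<Rightarrow> ('d::finite \<Rightarrow> real^'m^'m) \<Rightarrow> real^'m^'m \<Rightarrow> real^'d \<Rightarrow> ereal" where
  "bregman_loss F A S \<theta> = conjugate F (Lmap A \<theta>) - ereal (tr_inner (Lmap A \<theta>) S)"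

definition bregman_minimizer ::
    "(real^'m^'m \<Rightarrow> ereal) \<Rightarrow> ('d::finite \<Rightarrow> real^'m^'m) \<Rightarrow> real^'m^'m \<Rightarrow> real^'d \<Rightarrow> bool" where
  "bregman_minimizer F A S \<theta> \<longleftrightarrow> is_arg_min (bregman_loss F A S) (\<lambda>\<theta>. \<theta> \<in> Theta_plus F A) \<theta>"

definition outer :: "real^'m \<Rightarrow> real^'m \<Rightarrow> real^'m^'m" where
  "outer x y = (\<chi> i j. x $ i * y $ j)"

definition sample_cov :: "(nat \<Rightarrow> 'a \<Rightarrow> real^'m) \<Rightarrow> nat \<Rightarrow> 'a \<Rightarrow> real^'m^'m" where
  "sample_cov X n \<omega> = (1 / real n) *\<^sub>R (\<Sum>i=1..n. outer (X i \<omega>) (X i \<omega>))"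

text \<open>
  The estimator coincides with the minimizer (there is at most one) wherever a minimizer exists, and
  is unconstrained elsewhere; in particular it need not be measurable.
\<close>
definition is_bregman_estimator ::
    "(real^'m^'m \<Rightarrow> ereal) \<Rightarrow> ('d::finite \<Rightarrow> real^'m^'m) \<Rightarrow> 'a measure \<Rightarrow>
      (nat \<Rightarrow> 'a \<Rightarrow> real^'m) \<Rightarrow> (nat \<Rightarrow> 'a \<Rightarrow> real^'d) \<Rightarrow> bool" where
  "is_bregman_estimator F A P X est \<longleftrightarrow>
     (\<forall>n\<ge>1. \<forall>\<omega>\<in>space P. (\<exists>\<theta>. bregman_minimizer F A (sample_cov X n \<omega>) \<theta>) \<longrightarrow>
        bregman_minimizer F A (sample_cov X n \<omega>) (est n \<omega>))"

definition mean_vec :: "(real^'m) measure \<Rightarrow> real^'m" where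
  "mean_vec D = (\<integral>x. x \<partial>D)"

definition cov_mat :: "(real^'m) measure \<Rightarrow> real^'m^'m" where
  "cov_mat D = (\<integral>x. outer (x - mean_vec D) (x - mean_vec D) \<partial>D)"

text \<open>
  Convergence in probability to a constant. The outer measure equals the probability of the event
  whenever the event is measurable, so for random variables this is the usual notion; it also makes
  sense for the possibly non-measurable values of an estimator off the event where it is determined.
\<close>
definition converges_in_prob ::
    "'a measure \<Rightarrow> (nat \<Rightarrow> 'a \<Rightarrow> 'b::metric_space) \<Rightarrow> 'b \<Rightarrow> bool" where
  "converges_in_prob P Y c \<longleftrightarrow>
     (\<forall>\<epsilon>>0. (\<lambda>n. outer_measure_of P {\<omega>\<in>space P. dist (Y n \<omega>) c > \<epsilon>}) \<longlonglongrightarrow> 0)"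

end

theory Submission
  imports Defs
begin

text \<open>
  The idea is that the population loss has a strict minimum, that strict minima of convex functions
  are stable under small linear perturbations, and that replacing \<open>\<Sigma>\<^sub>0\<close> by \<open>S\<^sub>n\<close> is such a
  perturbation.

  The analytic core is \<open>convex_tilt_minimizer\<close>. Suppose that a convex function \<open>f\<close> lies strictly
  above its affine minorant of slope \<open>g\<close> through \<open>x\<^sub>0\<close>, and is finite and continuous near \<open>x\<^sub>0\<close>. On
  a small sphere around \<open>x\<^sub>0\<close> the gap is bounded below by compactness, and by convexity it grows at
  least linearly outside. Hence for every small \<open>s\<close> the function \<open>f - \<langle>g + s, \<cdot>\<rangle>\<close> attains its minimum,
  all its minimizers are close to \<open>x\<^sub>0\<close>, and \<open>g + s\<close> is a subgradient of \<open>f\<close> at each of them. The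
  lemma is used twice.

  \<^item> For \<open>F\<close> at a positive definite \<open>X\<close> with \<open>g = \<nabla>F(X)\<close>: every symmetric matrix near \<open>\<nabla>F(X)\<close> is
    \<open>\<nabla>F(Z)\<close> for some \<open>Z\<close> near \<open>X\<close> (\<open>sym_grad_open_at\<close>). Together with the Fenchel equality at \<open>X\<close>
    and \<open>Z\<close> this shows that \<open>F\<^sup>*\<close> is differentiable at \<open>\<nabla>F(X)\<close> with gradient \<open>X\<close>
    (\<open>conjugate_has_sym_gradient\<close>). Conversely \<open>X\<close> is the gradient of \<open>F\<^sup>*\<close> at no other point
    (\<open>conjugate_gradient_unique\<close>), which makes \<open>\<theta>\<^sub>0\<close> unique.

  \<^item> For \<open>\<theta> \<mapsto> F\<^sup>*(L(\<theta>))\<close> at \<open>\<theta>\<^sub>0\<close>, with \<open>g\<close> the coordinates of \<open>\<Sigma>\<^sub>0\<close>: once \<open>S\<close> is close to \<open>\<Sigma>\<^sub>0\<close>, a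
    minimizer of the Bregman loss exists, and every minimizer is close to \<open>\<theta>\<^sub>0\<close>
    (\<open>bregman_minimizer_near\<close>).

  It remains that \<open>S\<^sub>n \<rightarrow> \<Sigma>\<^sub>0\<close> in probability. As only second moments of \<open>X\<^sub>i\<close> are assumed, the
  entries of \<open>X\<^sub>i X\<^sub>i\<^sup>T\<close> are merely integrable, so the weak law of large numbers is proved by
  truncation, in the form of convergence in \<open>L\<^sup>1\<close> (\<open>weak_law_of_large_numbers_L1\<close>).
\<close>

section \<open>Strict minima of convex functions under linear perturbation\<close>

text \<open>
  The slope \<open>g\<close> is perturbed by \<open>s\<close>. The first conclusion, for points outside the ball of radius
  \<open>e\<close>, compares the perturbed function with its value at \<open>x0\<close>; the second gives a point \<open>z\<close> in the
  ball at which \<open>g + s\<close> is a subgradient.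
\<close>
lemma convex_tilt_minimizer:
  fixes f :: "'a::euclidean_space \<Rightarrow> ereal"
  assumes V: "subspace V" and x0: "x0 \<in> V"
    and conv: "ereal_convex_on V f"
    and e: "0 < e"
    and fin: "\<And>x. x \<in> V \<inter> cball x0 e \<Longrightarrow> \<bar>f x\<bar> \<noteq> \<infinity>"
    and cont: "continuous_on (V \<inter> cball x0 e) (\<lambda>x. real_of_ereal (f x))"
    and a: "f x0 = ereal a"
    and tangent: "\<And>x. x \<in> V \<Longrightarrow> x \<noteq> x0 \<Longrightarrow> ereal (a + g \<bullet> (x - x0)) < f x"
  obtains c where "0 < c"
    and "\<And>s y. norm s < c \<Longrightarrow> y \<in> V \<Longrightarrow> e \<le> dist y x0 \<Longrightarrow>
           ereal (a + (g + s) \<bullet> (y - x0)) < f y"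
    and "\<And>s. norm s < c \<Longrightarrow>
           \<exists>z b. z \<in> V \<and> dist z x0 < e \<and> f z = ereal b \<and>
             (\<forall>y\<in>V. ereal (b + (g + s) \<bullet> (y - z)) \<le> f y)"
proof -
  define \<phi> where "\<phi> x = real_of_ereal (f x)" for x
  have f\<phi>: "f x = ereal (\<phi> x)" if "x \<in> V" "dist x x0 \<le> e" for x
    using fin[of x] that by (simp add: \<phi>_def ereal_real dist_commute)
  have "\<phi> x0 = a" by (simp add: \<phi>_def a)
  have clV: "closed V" using V by (rule closed_subspace)
  define K where "K = V \<inter> sphere x0 e"
  have cK: "compact K" unfolding K_def by (simp add: clV closed_Int_compact)
  have contK: "continuous_on K (\<lambda>x. \<phi> x - a - g \<bullet> (x - x0))"
    unfolding \<phi>_def K_def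
    by (intro continuous_intros continuous_on_subset[OF cont]) auto
  \<comment> \<open>A positive lower bound of the gap on the sphere; the sphere is empty when \<open>V\<close> is trivial.\<close>
  obtain m where m: "0 < m" "\<And>x. x \<in> K \<Longrightarrow> m \<le> \<phi> x - a - g \<bullet> (x - x0)"
  proof (cases "K = {}")
    case True then show ?thesis using that[of 1] by auto
  next
    case False
    obtain w where w: "w \<in> K" "\<And>x. x \<in> K \<Longrightarrow> \<phi> w - a - g \<bullet> (w - x0) \<le> \<phi> x - a - g \<bullet> (x - x0)"
      using continuous_attains_inf[OF cK False contK] by blast
    have "w \<in> V" "dist w x0 = e" using w(1) by (auto simp: K_def dist_commute)
    with e have "ereal (a + g \<bullet> (w - x0)) < ereal (\<phi> w)"
      using tangent[of w] f\<phi>[of w] by auto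
    then show ?thesis using that[of "\<phi> w - a - g \<bullet> (w - x0)"] w by auto
  qed
  define c where "c = m / e"
  have c: "0 < c" using m e by (simp add: c_def)
  have far: "ereal (a + (g + s) \<bullet> (y - x0)) < f y"
    if s: "norm s < c" and y: "y \<in> V" and d: "e \<le> dist y x0" for s y
  proof (cases "f y")
    case PInf then show ?thesis by simp
  next
    case MInf
    have "y \<noteq> x0" using d e by auto
    then show ?thesis using tangent[OF y] MInf by auto
  next
    case (real b)
    define r where "r = norm (y - x0)"
    have r: "e \<le> r" "0 < r" using d e by (auto simp: r_def dist_norm)
    define t where "t = e / r"
    have t: "0 < t" "t \<le> 1" using r e by (auto simp: t_def)
    \<comment> \<open>The point where the segment from \<open>x0\<close> to \<open>y\<close> meets the sphere.\<close>
    define w where "w = (1 - t) *\<^sub>R x0 + t *\<^sub>R y"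
    have wx: "w - x0 = t *\<^sub>R (y - x0)" by (simp add: w_def algebra_simps)
    have wV: "w \<in> V" unfolding w_def using V x0 y by (simp add: subspace_add subspace_scale)
    have "norm (w - x0) = e" using r e by (simp add: wx t_def r_def[symmetric])
    then have wd: "dist w x0 = e" by (simp add: dist_norm)
    have "w \<in> K" using wV wd by (auto simp: K_def dist_commute)
    have "f w \<le> ereal (1 - t) * f x0 + ereal t * f y"
    proof (cases "t = 1")
      case True then show ?thesis by (simp add: w_def a)
    next
      case False
      then show ?thesis using conv t x0 y unfolding ereal_convex_on_def w_def by auto
    qed
    then have "\<phi> w \<le> (1 - t) * a + t * b"
      using f\<phi>[OF wV] wd by (simp add: a real)
    with m(2)[OF \<open>w \<in> K\<close>] have "m \<le> (1 - t) * a + t * b - a - g \<bullet> (t *\<^sub>R (y - x0))"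
      by (simp add: wx)
    then have "m \<le> t * (b - a - g \<bullet> (y - x0))" by (simp add: algebra_simps)
    then have "c * r \<le> b - a - g \<bullet> (y - x0)"
      using r e by (simp add: t_def c_def field_simps)
    moreover have "s \<bullet> (y - x0) \<le> norm s * r" unfolding r_def by (rule norm_cauchy_schwarz)
    moreover have "norm s * r < c * r" using s r by simp
    ultimately show ?thesis by (simp add: real inner_add_left)
  qed
  have "\<exists>z b. z \<in> V \<and> dist z x0 < e \<and> f z = ereal b \<and>
             (\<forall>y\<in>V. ereal (b + (g + s) \<bullet> (y - z)) \<le> f y)" if s: "norm s < c" for s
  proof -
    have "continuous_on (V \<inter> cball x0 e) (\<lambda>x. \<phi> x - (g + s) \<bullet> x)"
      unfolding \<phi>_def by (intro continuous_intros cont)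
    moreover have "compact (V \<inter> cball x0 e)" by (simp add: clV closed_Int_compact)
    moreover have ne: "x0 \<in> V \<inter> cball x0 e" using x0 e by simp
    ultimately obtain z where z: "z \<in> V \<inter> cball x0 e"
      "\<And>y. y \<in> V \<inter> cball x0 e \<Longrightarrow> \<phi> z - (g + s) \<bullet> z \<le> \<phi> y - (g + s) \<bullet> y"
      using continuous_attains_inf[of "V \<inter> cball x0 e"] by blast
    \<comment> \<open>By the estimate outside the ball, the minimum over the ball is a minimum over \<open>V\<close>.\<close>
    have zV: "z \<in> V" and zd: "dist z x0 \<le> e" using z(1) by (auto simp: dist_commute)
    have z0: "\<phi> z - (g + s) \<bullet> z \<le> a - (g + s) \<bullet> x0"
      using z(2)[OF ne] \<open>\<phi> x0 = a\<close> by simp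
    have "\<not> e \<le> dist z x0"
      using far[OF s zV] z0 f\<phi>[OF zV zd] by (auto simp: inner_diff_right)
    moreover have "ereal (\<phi> z + (g + s) \<bullet> (y - z)) \<le> f y" if y: "y \<in> V" for y
    proof (cases "e \<le> dist y x0")
      case True
      have "ereal (\<phi> z + (g + s) \<bullet> (y - z)) \<le> ereal (a + (g + s) \<bullet> (y - x0))"
        using z0 by (simp add: inner_diff_right)
      also have "\<dots> < f y" by (rule far[OF s y True])
      finally show ?thesis by simp
    next
      case False
      then show ?thesis using z(2)[of y] f\<phi>[OF y] y by (simp add: inner_diff_right dist_commute)
    qed
    ultimately show ?thesis using f\<phi>[OF zV zd] zV by (intro exI[of _ z] exI[of _ "\<phi> z"]) auto
  qed
  with c far that show thesis by blast
qed

section \<open>Gradients and subgradients on symmetric matrices\<close>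

lemma subspace_Sym: "subspace (Sym :: (real^'m^'m) set)"
  by (auto simp: subspace_def Sym_def transpose_def vec_eq_iff)

lemma Sym_add: "A \<in> Sym \<Longrightarrow> B \<in> Sym \<Longrightarrow> A + B \<in> Sym"
  by (rule subspace_add[OF subspace_Sym])

lemma Sym_diff: "A \<in> Sym \<Longrightarrow> B \<in> Sym \<Longrightarrow> A - B \<in> Sym"
  by (rule subspace_diff[OF subspace_Sym])

lemma Sym_scale: "A \<in> Sym \<Longrightarrow> c *\<^sub>R A \<in> Sym"
  by (rule subspace_scale[OF subspace_Sym])

lemma SymPD_subset_Sym: "SymPD \<subseteq> Sym"
  by (auto simp: SymPD_def)

lemma has_sym_gradientD:
  assumes "has_sym_gradient f G X" 
  shows "X \<in> Sym" "G \<in> Sym" "\<bar>f X\<bar> \<noteq> \<infinity>" 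
    "((\<lambda>Y. real_of_ereal (f Y)) has_derivative (\<lambda>H. G \<bullet> H)) (at X within Sym)"
proof -
  have "tr_inner G = (\<lambda>H. G \<bullet> H)"
    using assms by (simp add: fun_eq_iff has_sym_gradient_def tr_inner_eq_inner)
  then show "((\<lambda>Y. real_of_ereal (f Y)) has_derivative (\<lambda>H. G \<bullet> H)) (at X within Sym)"
    using assms by (simp add: has_sym_gradient_def)
qed (use assms in \<open>auto simp: has_sym_gradient_def\<close>)

lemma has_sym_gradient_line:
  assumes "has_sym_gradient f G X" and "H \<in> Sym"
  shows "((\<lambda>t. real_of_ereal (f (X + t *\<^sub>R H))) has_real_derivative G \<bullet> H) (at 0)"
    and "\<forall>\<^sub>F t in at 0. \<bar>f (X + t *\<^sub>R H)\<bar> \<noteq> \<infinity>"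
proof -
  note D = has_sym_gradientD[OF assms(1)]
  have sym: "X + t *\<^sub>R H \<in> Sym" for t
    using D(1) assms(2) by (simp add: Sym_add Sym_scale)
  have lin: "((\<lambda>t. X + t *\<^sub>R H) has_derivative (\<lambda>t. t *\<^sub>R H)) (at 0)"
    by (auto intro!: derivative_eq_intros)
  have "((\<lambda>Y. real_of_ereal (f Y)) has_derivative (\<lambda>H. G \<bullet> H))
          (at (X + 0 *\<^sub>R H) within range (\<lambda>t. X + t *\<^sub>R H))"
    using has_derivative_subset[OF D(4), of "range (\<lambda>t. X + t *\<^sub>R H)"] sym by auto
  from has_derivative_in_compose[OF lin this]
  show "((\<lambda>t. real_of_ereal (f (X + t *\<^sub>R H))) has_real_derivative G \<bullet> H) (at 0)"
    by (simp add: has_field_derivative_def mult_commute_abs)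
  obtain e where e: "0 < e" "\<And>Y. Y \<in> Sym \<Longrightarrow> Y \<noteq> X \<Longrightarrow> dist Y X < e \<Longrightarrow> \<bar>f Y\<bar> \<noteq> \<infinity>"
    using assms(1) unfolding has_sym_gradient_def eventually_at by metis
  have "((\<lambda>t. dist (X + t *\<^sub>R H) X) \<longlongrightarrow> dist (X + 0 *\<^sub>R H) X) (at 0)"
    by (intro tendsto_intros)
  then have "\<forall>\<^sub>F t in at 0. dist (X + t *\<^sub>R H) X < e"
    by (rule order_tendstoD(2)) (simp add: e(1))
  then show "\<forall>\<^sub>F t in at 0. \<bar>f (X + t *\<^sub>R H)\<bar> \<noteq> \<infinity>"
  proof eventually_elim
    case (elim t)
    show ?case
    proof (cases "X + t *\<^sub>R H = X")
      case True then show ?thesis using D(3) by (simp only: True) simp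
    next
      case False then show ?thesis using e(2)[OF sym] elim by simp
    qed
  qed
qed

text \<open>
  No convexity is needed: along each line through \<open>X\<close>, the difference of \<open>f\<close> and its affine minorant
  has a local minimum at \<open>X\<close>.
\<close>
lemma subgradient_eq_gradient:
  assumes G: "has_sym_gradient f G X" and L: "L \<in> Sym"
    and sub: "\<And>Y. Y \<in> Sym \<Longrightarrow> ereal (real_of_ereal (f X) + L \<bullet> (Y - X)) \<le> f Y"
  shows "L = G"
proof -
  note D = has_sym_gradientD[OF G]
  \<comment> \<open>The direction in which equality of the two slopes forces \<open>L = G\<close>.\<close>
  define H where "H = L - G"
  have H: "H \<in> Sym" unfolding H_def using L D(2) by (simp add: Sym_diff)
  have "((\<lambda>t. real_of_ereal (f (X + t *\<^sub>R H)) - L \<bullet> (t *\<^sub>R H)) has_real_derivative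
          G \<bullet> H - L \<bullet> H) (at 0)"
    by (auto intro!: derivative_eq_intros has_sym_gradient_line(1)[OF G H])
  moreover obtain d where d: "0 < d" "\<And>t. t \<noteq> 0 \<Longrightarrow> \<bar>t\<bar> < d \<Longrightarrow> \<bar>f (X + t *\<^sub>R H)\<bar> \<noteq> \<infinity>"
    using has_sym_gradient_line(2)[OF G H] unfolding eventually_at by auto
  have "real_of_ereal (f X) \<le> real_of_ereal (f (X + t *\<^sub>R H)) - L \<bullet> (t *\<^sub>R H)" if "\<bar>t\<bar> < d" for t
  proof (cases "t = 0")
    case False
    have "X + t *\<^sub>R H \<in> Sym" using D(1) H by (simp add: Sym_add Sym_scale)
    then have "ereal (real_of_ereal (f X) + L \<bullet> (t *\<^sub>R H)) \<le> f (X + t *\<^sub>R H)" 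
      using sub[of "X + t *\<^sub>R H"] by simp
    with d(2)[OF False that] show ?thesis by (cases "f (X + t *\<^sub>R H)") auto
  qed simp
  ultimately have "G \<bullet> H - L \<bullet> H = 0"
    using d(1) by (elim DERIV_local_min[of _ _ _ d]) auto
  then have "H \<bullet> H = 0" by (simp add: H_def inner_diff_left)
  then show ?thesis by (simp add: H_def)
qed

lemma has_sym_gradient_subgradient:
  assumes conv: "ereal_convex_on Sym f" and G: "has_sym_gradient f G X"
    and Y: "Y \<in> Sym" "f Y \<noteq> -\<infinity>"
  shows "ereal (real_of_ereal (f X) + G \<bullet> (Y - X)) \<le> f Y"
proof (cases "f Y")
  case (real b)
  note D = has_sym_gradientD[OF G]
  have YX: "Y - X \<in> Sym" using Y(1) D(1) by (simp add: Sym_diff)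
  define a where "a = real_of_ereal (f X)"
  have a: "f X = ereal a" using D(3) by (auto simp: a_def)
  define h where "h t = real_of_ereal (f (X + t *\<^sub>R (Y - X)))" for t
  have h0: "h 0 = a" by (simp add: h_def a_def)
  have "(h has_real_derivative G \<bullet> (Y - X)) (at 0)"
    unfolding h_def by (rule has_sym_gradient_line(1)[OF G YX])
  then have "((\<lambda>t. (h t - a) / t) \<longlongrightarrow> G \<bullet> (Y - X)) (at 0)"
    by (simp add: has_field_derivative_iff h0)
  then have lim: "((\<lambda>t. (h t - a) / t) \<longlongrightarrow> G \<bullet> (Y - X)) (at_right 0)"
    by (rule tendsto_mono[OF at_le, rotated]) simp
  have "\<forall>\<^sub>F t in at_right (0::real). \<bar>f (X + t *\<^sub>R (Y - X))\<bar> \<noteq> \<infinity>"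
    using has_sym_gradient_line(2)[OF G YX] by (simp add: eventually_at_split)
  moreover have "\<forall>\<^sub>F t in at_right (0::real). 0 < t \<and> t < 1"
    using eventually_at_right_real[of 0 1] by simp
  ultimately have "\<forall>\<^sub>F t in at_right 0. (h t - a) / t \<le> b - a"
  proof eventually_elim
    case (elim t)
    have "X + t *\<^sub>R (Y - X) = (1 - t) *\<^sub>R X + t *\<^sub>R Y" by (simp add: algebra_simps)
    then have "f (X + t *\<^sub>R (Y - X)) \<le> ereal (1 - t) * f X + ereal t * f Y"
      using conv elim Y(1) D(1) unfolding ereal_convex_on_def by auto
    with elim(1) have "h t \<le> (1 - t) * a + t * b"
      by (cases "f (X + t *\<^sub>R (Y - X))") (auto simp: h_def a real)
    then have "h t - a \<le> (b - a) * t" by (simp add: algebra_simps)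
    then show ?case using elim(2) by (simp add: divide_le_eq)
  qed
  then have "G \<bullet> (Y - X) \<le> b - a"
    by (intro tendsto_upperbound[OF lim]) auto
  then show ?thesis by (simp add: real a)
qed (use Y in auto)

lemma has_sym_gradient_unique:
  assumes "has_sym_gradient f G X" "has_sym_gradient f G' X" shows "G = G'"
proof -
  have H: "G - G' \<in> Sym"
    by (rule Sym_diff[OF has_sym_gradientD(2)[OF assms(1)] has_sym_gradientD(2)[OF assms(2)]])
  have "G \<bullet> (G - G') = G' \<bullet> (G - G')"
    using has_sym_gradient_line(1)[OF assms(1) H] has_sym_gradient_line(1)[OF assms(2) H]
    by (rule DERIV_unique)
  then have "(G - G') \<bullet> (G - G') = 0" by (simp add: inner_diff_left)
  then show ?thesis by simp
qed

section \<open>The gradient map on positive definite matrices\<close>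

lemma inner_matrix_vector_mult: "x \<bullet> (B *v y) = B \<bullet> outer x y"
  unfolding inner_vec_def matrix_vector_mult_def outer_def
  by (auto simp: sum_distrib_left intro!: sum.cong)

lemma norm_outer: "norm (outer x y) = norm x * norm y"
proof -
  have "outer x y \<bullet> outer x y = (x \<bullet> x) * (y \<bullet> y)"
    unfolding inner_vec_def outer_def sum_product by (auto intro!: sum.cong)
  then show ?thesis by (simp add: norm_eq_sqrt_inner real_sqrt_mult)
qed

text \<open>The positive definite matrices are relatively open in \<open>Sym\<close>: the radius is the least eigenvalue.\<close>
lemma SymPD_nbhd:
  fixes B :: "real^'m^'m"
  assumes "B \<in> SymPD"
  obtains e where "0 < e" "\<And>C. C \<in> Sym \<Longrightarrow> dist C B < e \<Longrightarrow> C \<in> SymPD"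
proof -
  have "continuous_on (sphere 0 1) (\<lambda>x. x \<bullet> (B *v x))"
    by (intro continuous_on_inner continuous_on_id matrix_vector_mult_linear_continuous_on)
  moreover have "sphere (0 :: real^'m) 1 \<noteq> {}" by simp
  ultimately have "\<exists>w\<in>sphere 0 1. \<forall>u\<in>sphere 0 1. w \<bullet> (B *v w) \<le> u \<bullet> (B *v u)"
    by (intro continuous_attains_inf compact_sphere)
  then obtain w where w: "norm w = 1" "\<And>u. norm u = 1 \<Longrightarrow> w \<bullet> (B *v w) \<le> u \<bullet> (B *v u)"
    by auto
  define e where "e = w \<bullet> (B *v w)"
  have "w \<noteq> 0" using w(1) by auto
  then have e: "0 < e" using assms unfolding e_def SymPD_def by auto
  have "C \<in> SymPD" if C: "C \<in> Sym" "dist C B < e" for C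
  proof -
    have "0 < x \<bullet> (C *v x)" if "x \<noteq> 0" for x
    proof -
      define u where "u = x /\<^sub>R norm x"
      have u: "norm u = 1" "x = norm x *\<^sub>R u" using that by (auto simp: u_def)
      have "(B - C) \<bullet> outer u u \<le> norm (B - C)"
        using norm_cauchy_schwarz[of "B - C" "outer u u"] by (simp add: norm_outer u(1))
      also have "\<dots> < e" using C(2) by (simp add: dist_norm norm_minus_commute)
      also have "\<dots> \<le> B \<bullet> outer u u" using w(2)[OF u(1)] by (simp add: e_def inner_matrix_vector_mult)
      finally have "0 < u \<bullet> (C *v u)" by (simp add: inner_diff_left inner_matrix_vector_mult)
      moreover have "x \<bullet> (C *v x) = (norm x)\<^sup>2 * (u \<bullet> (C *v u))"
        by (subst (1 2) u(2)) (simp add: matrix_vector_mult_scaleR power2_eq_square)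
      ultimately show ?thesis using that by simp
    qed
    then show ?thesis using C(1) by (simp add: SymPD_def)
  qed
  with e that show thesis by blast
qed

lemma bregman_class_D:
  assumes "F \<in> bregman_class"
  shows "\<And>Y. Y \<in> Sym \<Longrightarrow> F Y \<noteq> -\<infinity>"
    and "ereal_convex_on Sym F"
    and "ereal_strictly_convex_on SymPD F"
  using assms by (auto simp: bregman_class_def)

lemma bregman_class_gradient:
  assumes "F \<in> bregman_class" "X \<in> SymPD"
  shows "has_sym_gradient F (sym_grad F X) X"
proof -
  obtain G where "has_sym_gradient F G X"
    using assms by (auto simp: bregman_class_def)
  then show ?thesis
    unfolding sym_grad_def by (rule theI) (rule has_sym_gradient_unique[OF _ \<open>has_sym_gradient F G X\<close>])
qed

lemma bregman_class_finite:
  assumes "F \<in> bregman_class" "X \<in> SymPD"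
  shows "F X = ereal (real_of_ereal (F X))"
  using has_sym_gradientD(3)[OF bregman_class_gradient[OF assms]] by (simp add: ereal_real)

lemma bregman_class_tangent:
  assumes "F \<in> bregman_class" "X \<in> SymPD" "Y \<in> Sym"
  shows "ereal (real_of_ereal (F X) + sym_grad F X \<bullet> (Y - X)) \<le> F Y"
  using has_sym_gradient_subgradient[OF bregman_class_D(2) bregman_class_gradient]
    bregman_class_D(1) assms by blast

text \<open>
  Strict convexity is available on \<open>SymPD\<close> only, while \<open>Y\<close> ranges over all of \<open>Sym\<close>. If \<open>F\<close> touched
  its tangent at \<open>Y\<close>, then by convexity it would coincide with the tangent on the segment from \<open>X\<close>
  to \<open>Y\<close>, whose part near \<open>X\<close> lies in \<open>SymPD\<close>.
\<close>
lemma bregman_class_strict_tangent: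
  assumes F: "F \<in> bregman_class" and X: "X \<in> SymPD" and Y: "Y \<in> Sym" "Y \<noteq> X"
  shows "ereal (real_of_ereal (F X) + sym_grad F X \<bullet> (Y - X)) < F Y"
proof (rule ccontr)
  define G where "G = sym_grad F X"
  define a where "a = real_of_ereal (F X)"
  have a: "F X = ereal a" unfolding a_def by (rule bregman_class_finite[OF F X])
  have XS: "X \<in> Sym" using X SymPD_subset_Sym by auto
  have tangent: "ereal (a + G \<bullet> (Z - X)) \<le> F Z" if "Z \<in> Sym" for Z
    using bregman_class_tangent[OF F X that] by (simp add: G_def a_def)
  assume "\<not> ?thesis"
  with tangent[OF Y(1)] have FY: "F Y = ereal (a + G \<bullet> (Y - X))" by (simp add: G_def a_def)
  obtain e where e: "0 < e" "\<And>C. C \<in> Sym \<Longrightarrow> dist C X < e \<Longrightarrow> C \<in> SymPD"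
    using SymPD_nbhd[OF X] by blast
  define r where "r = norm (Y - X)"
  have r: "0 < r" using Y(2) by (simp add: r_def)
  \<comment> \<open>The factor puts \<open>W\<close> below into the ball of radius \<open>e\<close>, hence into \<open>SymPD\<close>.\<close>
  define t where "t = min (1/2) (e / (2 * r))"
  have t: "0 < t" "t < 1" using e r by (auto simp: t_def)
  have "t * r \<le> e / (2 * r) * r" using r by (intro mult_right_mono) (auto simp: t_def)
  then have tr: "t * r < e" using e r by simp
  define W where "W = (1 - t) *\<^sub>R X + t *\<^sub>R Y"
  have WX: "W - X = t *\<^sub>R (Y - X)" by (simp add: W_def algebra_simps)
  have "W \<in> Sym" unfolding W_def by (intro Sym_add Sym_scale XS Y)
  moreover have "dist W X = t * r" using t by (simp add: dist_norm WX r_def)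
  ultimately have W: "W \<in> SymPD" using e(2) tr by simp
  have "W \<noteq> X" using WX t Y(2) by auto
  have "F W \<le> ereal (1 - t) * F X + ereal t * F Y"
    using bregman_class_D(2)[OF F] XS Y t unfolding ereal_convex_on_def W_def by blast
  then have FW: "F W \<le> ereal (a + t * (G \<bullet> (Y - X)))" by (simp add: a FY algebra_simps)
  define M where "M = (1 - 1/2) *\<^sub>R X + (1/2) *\<^sub>R W"
  have "F M < ereal (1 - 1/2) * F X + ereal (1/2) * F W"
    unfolding M_def
    by (rule bregman_class_D(3)[OF F, unfolded ereal_strictly_convex_on_def, THEN conjunct2, rule_format])
       (use X W \<open>W \<noteq> X\<close> in auto)
  also have "\<dots> \<le> ereal (a + t / 2 * (G \<bullet> (Y - X)))"
    using FW bregman_class_finite[OF F W] by (cases "F W") (auto simp: a field_simps)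
  also have "\<dots> \<le> F M"
  proof -
    have "M - X = (1/2) *\<^sub>R (W - X)" by (simp add: M_def algebra_simps flip: scaleR_add_left)
    moreover have "M \<in> Sym" unfolding M_def by (intro Sym_add Sym_scale XS \<open>W \<in> Sym\<close>)
    ultimately show ?thesis using tangent[of M] by (simp add: WX)
  qed
  finally show False by simp
qed

lemma bregman_class_continuous_on:
  assumes F: "F \<in> bregman_class" and sub: "T \<subseteq> SymPD"
  shows "continuous_on T (\<lambda>X. real_of_ereal (F X))"
proof -
  have "continuous_on SymPD (\<lambda>X. real_of_ereal (F X))"
    unfolding continuous_on_eq_continuous_within
    using has_derivative_continuous[OF has_sym_gradientD(4)[OF bregman_class_gradient[OF F]]]
      continuous_within_subset[OF _ SymPD_subset_Sym] by blast
  then show ?thesis using sub by (rule continuous_on_subset)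
qed

text \<open>
  The gradient map is open at each positive definite \<open>X\<close>. No inverse function theorem or invariance
  of domain is needed: \<open>Z\<close> is the minimizer of \<open>F - \<langle>L, \<cdot>\<rangle>\<close>.
\<close>
lemma sym_grad_open_at:
  assumes F: "F \<in> bregman_class" and X: "X \<in> SymPD" and "0 < e"
  obtains c where "0 < c"
    and "\<And>L. L \<in> Sym \<Longrightarrow> dist L (sym_grad F X) < c \<Longrightarrow>
           \<exists>Z. Z \<in> SymPD \<and> dist Z X < e \<and> sym_grad F Z = L"
proof -
  obtain e' where e': "0 < e'" "\<And>C. C \<in> Sym \<Longrightarrow> dist C X < e' \<Longrightarrow> C \<in> SymPD"
    using SymPD_nbhd[OF X] by blast
  define r where "r = min e (e' / 2)"
  have r: "0 < r" "r \<le> e" "r < e'" using assms e' by (auto simp: r_def min_def)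
  have XS: "X \<in> Sym" using X SymPD_subset_Sym by auto
  have PD: "Sym \<inter> cball X r \<subseteq> SymPD" using e'(2) r by (auto simp: dist_commute)
  have fin: "\<bar>F Z\<bar> \<noteq> \<infinity>" if "Z \<in> Sym \<inter> cball X r" for Z
    by (subst bregman_class_finite[OF F]) (use PD that in auto)
  show thesis
  proof (rule convex_tilt_minimizer[OF subspace_Sym XS bregman_class_D(2)[OF F] r(1) fin
        bregman_class_continuous_on[OF F PD] bregman_class_finite[OF F X] bregman_class_strict_tangent[OF F X]])
    fix c assume c: "0 < c"
      "\<And>s. norm s < c \<Longrightarrow> \<exists>Z b. Z \<in> Sym \<and> dist Z X < r \<and> F Z = ereal b \<and>
        (\<forall>Y\<in>Sym. ereal (b + (sym_grad F X + s) \<bullet> (Y - Z)) \<le> F Y)"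
    have "\<exists>Z. Z \<in> SymPD \<and> dist Z X < e \<and> sym_grad F Z = L"
      if L: "L \<in> Sym" "dist L (sym_grad F X) < c" for L
    proof -
      obtain Z b where Z: "Z \<in> Sym" "dist Z X < r" "F Z = ereal b"
        "\<And>Y. Y \<in> Sym \<Longrightarrow> ereal (b + L \<bullet> (Y - Z)) \<le> F Y"
        using c(2)[of "L - sym_grad F X"] L(2) by (auto simp: dist_norm)
      have ZPD: "Z \<in> SymPD" using PD Z by (auto simp: dist_commute)
      have "L = sym_grad F Z"
        using subgradient_eq_gradient[OF bregman_class_gradient[OF F ZPD] L(1)] Z by simp
      then show ?thesis using ZPD Z(2) r(2) by auto
    qed
    with c(1) show thesis by (rule that)
  qed
qed

section \<open>The conjugate function\<close>

lemma conjugate_upper: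
  assumes "X \<in> Sym" "F X = ereal b"
  shows "ereal (L \<bullet> X - b) \<le> conjugate F L"
  using SUP_upper[OF assms(1), of "\<lambda>X. ereal (tr_inner X L) - F X"] assms
  by (simp add: conjugate_def tr_inner_eq_inner inner_commute)

text \<open>The equality case of the Fenchel inequality, in both directions.\<close>
lemma conjugate_eq_if_subgradient:
  assumes X: "X \<in> Sym" "F X = ereal b"
    and sub: "\<And>Y. Y \<in> Sym \<Longrightarrow> ereal (b + L \<bullet> (Y - X)) \<le> F Y"
  shows "conjugate F L = ereal (L \<bullet> X - b)"
proof (rule antisym)
  show "conjugate F L \<le> ereal (L \<bullet> X - b)"
    unfolding conjugate_def
  proof (rule SUP_least)
    fix Y :: "real^'a^'a" assume Y: "Y \<in> Sym"
    show "ereal (tr_inner Y L) - F Y \<le> ereal (L \<bullet> X - b)"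
      using sub[OF Y] by (cases "F Y") (auto simp: tr_inner_eq_inner[OF Y] inner_commute inner_diff_right)
  qed
qed (rule conjugate_upper[where F = F, OF X])

lemma subgradient_if_conjugate_le:
  assumes neq: "\<And>Y. Y \<in> Sym \<Longrightarrow> F Y \<noteq> -\<infinity>"
    and le: "conjugate F L \<le> ereal (L \<bullet> X - b)" and Y: "Y \<in> Sym"
  shows "ereal (b + L \<bullet> (Y - X)) \<le> F Y"
proof (cases "F Y")
  case (real y)
  have "ereal (L \<bullet> Y - y) \<le> ereal (L \<bullet> X - b)"
    using conjugate_upper[where F = F, OF Y real] le by (rule order_trans)
  then show ?thesis by (simp add: real inner_diff_right)
qed (use neq[OF Y] in auto)

lemma ereal_convex_on_conjugate:
  assumes neq: "\<And>Y. Y \<in> Sym \<Longrightarrow> F Y \<noteq> -\<infinity>"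
  shows "ereal_convex_on Sym (conjugate F)"
  unfolding ereal_convex_on_def
proof (intro conjI ballI allI impI)
  show "convex (Sym :: (real^'a^'a) set)" using subspace_Sym by (rule subspace_imp_convex)
next
  fix L L' :: "real^'a^'a" and t :: real
  assume t: "0 < t \<and> t < 1"
  show "conjugate F ((1 - t) *\<^sub>R L + t *\<^sub>R L')
          \<le> ereal (1 - t) * conjugate F L + ereal t * conjugate F L'"
    unfolding conjugate_def[of F "(1 - t) *\<^sub>R L + t *\<^sub>R L'"]
  proof (rule SUP_least)
    fix Y :: "real^'a^'a" assume Y: "Y \<in> Sym"
    show "ereal (tr_inner Y ((1 - t) *\<^sub>R L + t *\<^sub>R L')) - F Y
            \<le> ereal (1 - t) * conjugate F L + ereal t * conjugate F L'"
    proof (cases "F Y")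
      case (real y)
      have "ereal (tr_inner Y ((1 - t) *\<^sub>R L + t *\<^sub>R L')) - F Y
              = ereal (1 - t) * ereal (L \<bullet> Y - y) + ereal t * ereal (L' \<bullet> Y - y)"
        by (simp add: real tr_inner_eq_inner[OF Y] inner_commute[of Y] inner_add_left algebra_simps)
      also have "\<dots> \<le> ereal (1 - t) * conjugate F L + ereal t * conjugate F L'"
        using t by (intro add_mono ereal_mult_left_mono conjugate_upper[where F = F, OF Y real]) auto
      finally show ?thesis .
    qed (use neq[OF Y] in auto)
  qed
qed

lemma conjugate_at_gradient:
  assumes F: "F \<in> bregman_class" and X: "X \<in> SymPD"
  shows "conjugate F (sym_grad F X) = ereal (sym_grad F X \<bullet> X - real_of_ereal (F X))"
  using conjugate_eq_if_subgradient bregman_class_finite[OF F X] bregman_class_tangent[OF F X]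
    X SymPD_subset_Sym by blast

lemma sym_grad_if_conjugate_le:
  assumes F: "F \<in> bregman_class" and X: "X \<in> SymPD" and L: "L \<in> Sym"
    and le: "conjugate F L \<le> ereal (L \<bullet> X - real_of_ereal (F X))"
  shows "L = sym_grad F X"
  using subgradient_eq_gradient[OF bregman_class_gradient[OF F X] L]
    subgradient_if_conjugate_le[OF bregman_class_D(1)[OF F] le] by blast

lemma conjugate_has_sym_gradient:
  assumes F: "F \<in> bregman_class" and X: "X \<in> SymPD"
  shows "has_sym_gradient (conjugate F) X (sym_grad F X)"
proof -
  define L where "L = sym_grad F X"
  have XS: "X \<in> Sym" using X SymPD_subset_Sym by auto
  have LS: "L \<in> Sym" using has_sym_gradientD(2)[OF bregman_class_gradient[OF F X]] by (simp add: L_def)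
  have cL: "conjugate F L = ereal (L \<bullet> X - real_of_ereal (F X))"
    unfolding L_def by (rule conjugate_at_gradient[OF F X])
  have "((\<lambda>L'. real_of_ereal (conjugate F L')) has_derivative (\<lambda>H. X \<bullet> H)) (at L within Sym)"
    unfolding has_derivative_within_alt
  proof (intro conjI allI impI)
    show "bounded_linear (\<lambda>H. X \<bullet> H)" by (rule bounded_linear_inner_right)
    fix e :: real assume e: "0 < e"
    obtain c where c: "0 < c"
      "\<And>L'. L' \<in> Sym \<Longrightarrow> dist L' L < c \<Longrightarrow> \<exists>Z. Z \<in> SymPD \<and> dist Z X < e \<and> sym_grad F Z = L'"
      using sym_grad_open_at[OF F X e] unfolding L_def by metis
    have "norm (real_of_ereal (conjugate F L') - real_of_ereal (conjugate F L) - X \<bullet> (L' - L))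
            \<le> e * norm (L' - L)" if L': "L' \<in> Sym" "norm (L' - L) < c" for L'
    proof -
      obtain Z where Z: "Z \<in> SymPD" "dist Z X < e" "sym_grad F Z = L'"
        using c(2)[OF L'(1)] L'(2) unfolding dist_norm by blast
      have ZS: "Z \<in> Sym" using Z SymPD_subset_Sym by auto
      define x z where "x = real_of_ereal (F X)" and "z = real_of_ereal (F Z)"
      have cL': "conjugate F L' = ereal (L' \<bullet> Z - z)"
        using conjugate_at_gradient[OF F Z(1)] by (simp add: Z(3) z_def)
      have X': "F X = ereal x" and Z': "F Z = ereal z"
        using bregman_class_finite[OF F X] bregman_class_finite[OF F Z(1)] by (simp_all add: x_def z_def)
      have 1: "z + L' \<bullet> (X - Z) \<le> x"
        using bregman_class_tangent[OF F Z(1) XS] X' Z' by (simp add: Z(3))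
      have 2: "x + L \<bullet> (Z - X) \<le> z"
        using bregman_class_tangent[OF F X ZS] X' Z' by (simp add: L_def)
      \<comment> \<open>The remainder lies between 0 and \<open>\<langle>L' - L, Z - X\<rangle>\<close>, by the tangents of \<open>F\<close> at \<open>Z\<close> and \<open>X\<close>.\<close>
      define err where "err = L' \<bullet> Z - z - (L \<bullet> X - x) - X \<bullet> (L' - L)"
      have "0 \<le> err" using 1 by (simp add: err_def inner_diff_right inner_commute[of X])
      moreover have "err \<le> (L' - L) \<bullet> (Z - X)"
        using 2 by (simp add: err_def inner_diff_right inner_diff_left inner_commute[of X])
      moreover have "(L' - L) \<bullet> (Z - X) \<le> norm (L' - L) * norm (Z - X)" by (rule norm_cauchy_schwarz)
      moreover have "\<dots> \<le> norm (L' - L) * e" using Z(2) by (intro mult_left_mono) (auto simp: dist_norm)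
      ultimately have "\<bar>err\<bar> \<le> e * norm (L' - L)" by (simp add: mult.commute)
      then show ?thesis by (simp add: err_def cL cL' x_def)
    qed
    then show "\<exists>d>0. \<forall>L'\<in>Sym. norm (L' - L) < d \<longrightarrow>
        norm (real_of_ereal (conjugate F L') - real_of_ereal (conjugate F L) - X \<bullet> (L' - L))
          \<le> e * norm (L' - L)"
      by (intro exI[of _ c] conjI c(1) ballI impI)
  qed
  moreover have "\<forall>\<^sub>F L' in at L within Sym. \<bar>conjugate F L'\<bar> \<noteq> \<infinity>"
  proof -
    obtain c where c: "0 < c"
      "\<And>L'. L' \<in> Sym \<Longrightarrow> dist L' L < c \<Longrightarrow> \<exists>Z. Z \<in> SymPD \<and> dist Z X < 1 \<and> sym_grad F Z = L'"
      using sym_grad_open_at[OF F X zero_less_one] unfolding L_def by metis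
    have "\<bar>conjugate F L'\<bar> \<noteq> \<infinity>" if L': "L' \<in> Sym" "dist L' L < c" for L'
    proof -
      obtain Z where "Z \<in> SymPD" "sym_grad F Z = L'" using c(2)[OF L'] by blast
      then show ?thesis using conjugate_at_gradient[OF F, of Z] by simp
    qed
    then show ?thesis unfolding eventually_at by (intro exI[of _ c] conjI c(1) ballI impI) simp
  qed
  moreover have "tr_inner X = (\<lambda>H. X \<bullet> H)" using XS by (simp add: fun_eq_iff tr_inner_eq_inner)
  ultimately show ?thesis
    unfolding has_sym_gradient_def L_def[symmetric] using XS LS cL by simp
qed

text \<open>
  If \<open>X\<close> is the gradient of the conjugate at \<open>L\<close>, then the Fenchel inequality for \<open>X\<close> and \<open>L\<close> is an
  equality, so that \<open>L\<close> is a subgradient of \<open>F\<close> at \<open>X\<close>.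
\<close>
lemma conjugate_gradient_unique:
  assumes F: "F \<in> bregman_class" and X: "X \<in> SymPD"
    and G: "has_sym_gradient (conjugate F) X L"
  shows "L = sym_grad F X"
proof -
  note D = has_sym_gradientD[OF G]
  define L0 where "L0 = sym_grad F X"
  have L0: "L0 \<in> Sym" using has_sym_gradientD(2)[OF bregman_class_gradient[OF F X]] by (simp add: L0_def)
  have c: "conjugate F L0 = ereal (L0 \<bullet> X - real_of_ereal (F X))"
    unfolding L0_def by (rule conjugate_at_gradient[OF F X])
  have "ereal (real_of_ereal (conjugate F L) + X \<bullet> (L0 - L)) \<le> conjugate F L0"
    by (rule has_sym_gradient_subgradient[OF ereal_convex_on_conjugate[OF bregman_class_D(1)[OF F]] G L0])
       (simp_all add: c)
  then have "real_of_ereal (conjugate F L) \<le> L \<bullet> X - real_of_ereal (F X)"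
    by (simp add: c inner_diff_right inner_commute)
  then have "conjugate F L \<le> ereal (L \<bullet> X - real_of_ereal (F X))"
    using D(3) by (cases "conjugate F L") auto
  then show ?thesis by (rule sym_grad_if_conjugate_le[OF F X D(1)])
qed

section \<open>Stability of the Bregman minimizer\<close>

lemma orthonormal_basis_inner:
  assumes "orthonormal_basis A \<L>" "\<L> \<subseteq> Sym"
  shows "A i \<in> Sym" "A i \<bullet> A j = (if i = j then 1 else 0)"
proof -
  show "A i \<in> Sym" using assms unfolding orthonormal_basis_def by blast
  then show "A i \<bullet> A j = (if i = j then 1 else 0)"
    using assms(1) tr_inner_eq_inner[of "A i" "A j"] by (simp add: orthonormal_basis_def)
qed

lemma linear_Lmap: "linear (Lmap A)"
  by (rule linearI) (simp_all add: Lmap_def scaleR_add_left sum.distrib scaleR_sum_right)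

lemma span_subset_range_Lmap: "span (range A) \<subseteq> range (Lmap A)"
proof (rule span_minimal)
  have "A i = Lmap A (axis i 1)" for i
    by (simp add: Lmap_def axis_def if_distrib[of "\<lambda>c. c *\<^sub>R _"] cong: if_cong)
  then show "range A \<subseteq> range (Lmap A)" by blast
  show "subspace (range (Lmap A))" by (rule linear_subspace_image[OF linear_Lmap subspace_UNIV])
qed

lemma Lmap_inner: "Lmap A \<theta> \<bullet> B = \<theta> \<bullet> (\<chi> i. A i \<bullet> B)"
  by (simp add: Lmap_def inner_sum_left inner_vec_def[where 'b = 'b])

lemma Lmap_in_Sym:
  assumes "\<And>i. A i \<in> Sym" shows "Lmap A \<theta> \<in> Sym"
  unfolding Lmap_def by (intro subspace_sum[OF subspace_Sym] Sym_scale assms)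

lemma norm_Lmap:
  assumes "orthonormal_basis A \<L>" "\<L> \<subseteq> Sym"
  shows "norm (Lmap A \<theta>) = norm \<theta>"
proof -
  have "A i \<bullet> Lmap A \<theta> = \<theta> $ i" for i
    by (simp add: Lmap_def inner_sum_right orthonormal_basis_inner[OF assms] if_distrib cong: if_cong)
  then show ?thesis by (simp add: norm_eq_sqrt_inner Lmap_inner[of A \<theta> "Lmap A \<theta>"])
qed

lemma dist_Lmap:
  assumes "orthonormal_basis A \<L>" "\<L> \<subseteq> Sym"
  shows "dist (Lmap A \<theta>) (Lmap A \<theta>') = dist \<theta> \<theta>'"
  using norm_Lmap[OF assms, of "\<theta> - \<theta>'"] by (simp add: dist_norm linear_diff[OF linear_Lmap])

text \<open>Bessel's inequality for the coordinates of \<open>B\<close>.\<close>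
lemma norm_coordinates_le:
  assumes "orthonormal_basis A \<L>" "\<L> \<subseteq> Sym"
  shows "norm (\<chi> i. A i \<bullet> B) \<le> norm B"
proof -
  define s where "s = (\<chi> i. A i \<bullet> B)"
  have "s \<bullet> s = Lmap A s \<bullet> B" by (simp add: Lmap_inner s_def)
  also have "\<dots> \<le> norm s * norm B"
    using norm_cauchy_schwarz[of "Lmap A s" B] by (simp add: norm_Lmap[OF assms])
  finally have "norm s * norm s \<le> norm s * norm B" by (simp add: dot_square_norm power2_eq_square)
  then have "norm s \<le> norm B" by (cases "norm s = 0") (auto simp: mult_le_cancel_left)
  then show ?thesis by (simp only: s_def)
qed

lemma bregman_loss_eq:
  assumes "\<And>i. A i \<in> Sym"
  shows "bregman_loss F A S \<theta> = conjugate F (Lmap A \<theta>) - ereal ((\<chi> i. A i \<bullet> S) \<bullet> \<theta>)"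
  unfolding bregman_loss_def tr_inner_eq_inner[where A = "Lmap A \<theta>", OF Lmap_in_Sym[OF assms]] Lmap_inner
  by (simp only: inner_commute)

lemma ereal_convex_on_conjugate_Lmap:
  assumes "F \<in> bregman_class" and "\<And>i. A i \<in> Sym"
  shows "ereal_convex_on UNIV (\<lambda>\<theta>. conjugate F (Lmap A \<theta>))"
  using ereal_convex_on_conjugate[where F = F, OF bregman_class_D(1)[OF assms(1)]] Lmap_in_Sym[where A = A, OF assms(2)]
  by (simp add: ereal_convex_on_def linear_add[OF linear_Lmap] linear_scale[OF linear_Lmap])

lemma Lplus_in_Sym: "F \<in> bregman_class \<Longrightarrow> L \<in> Lplus F \<Longrightarrow> L \<in> Sym"
  using has_sym_gradientD(2)[OF bregman_class_gradient] by (auto simp: Lplus_def)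

lemma conjugate_finite_on_Lplus:
  assumes "F \<in> bregman_class" "L \<in> Lplus F"
  shows "\<bar>conjugate F L\<bar> \<noteq> \<infinity>"
  using conjugate_at_gradient[OF assms(1)] assms(2) by (auto simp: Lplus_def)

lemma continuous_on_conjugate:
  assumes "F \<in> bregman_class"
  shows "continuous_on (Lplus F) (\<lambda>L. real_of_ereal (conjugate F L))"
  unfolding continuous_on_eq_continuous_within
proof
  fix L assume "L \<in> Lplus F"
  then obtain X where X: "X \<in> SymPD" "L = sym_grad F X" by (auto simp: Lplus_def)
  have "continuous (at L within Sym) (\<lambda>L. real_of_ereal (conjugate F L))"
    unfolding X(2)
    by (rule has_derivative_continuous[OF has_sym_gradientD(4)[OF conjugate_has_sym_gradient[OF assms X(1)]]])
  then show "continuous (at L within Lplus F) (\<lambda>L. real_of_ereal (conjugate F L))"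
    by (rule continuous_within_subset) (use Lplus_in_Sym[OF assms] in auto)
qed

text \<open>
  Deterministic consistency. The loss with matrix \<open>S\<close> differs from the loss with matrix \<open>X\<close> by a
  linear functional of \<open>\<theta>\<close>, whose norm is at most the norm of \<open>S - X\<close>.
\<close>
lemma bregman_minimizer_near:
  fixes A :: "'d::finite \<Rightarrow> real^'m^'m"
  assumes F: "F \<in> bregman_class" and A: "orthonormal_basis A \<L>" "\<L> \<subseteq> Sym"
    and X: "X \<in> SymPD" and \<theta>0: "Lmap A \<theta>0 = sym_grad F X" and e: "0 < e"
  obtains \<delta> where "0 < \<delta>"
    and "\<And>S. norm (S - X) < \<delta> \<Longrightarrow> \<exists>\<theta>. bregman_minimizer F A S \<theta>"
    and "\<And>S \<theta>. norm (S - X) < \<delta> \<Longrightarrow> bregman_minimizer F A S \<theta> \<Longrightarrow> dist \<theta> \<theta>0 < e"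
proof -
  note AS = orthonormal_basis_inner(1)[OF A]
  note LS = Lmap_in_Sym[where A = A, OF AS]
  obtain c where c: "0 < c" "\<And>L. L \<in> Sym \<Longrightarrow> dist L (sym_grad F X) < c \<Longrightarrow>
      \<exists>Z. Z \<in> SymPD \<and> dist Z X < 1 \<and> sym_grad F Z = L"
    using sym_grad_open_at[OF F X zero_less_one] by metis
  have Lplus: "L \<in> Lplus F" if L: "L \<in> Sym" "dist L (sym_grad F X) < c" for L
    unfolding Lplus_def using c(2)[OF L] by blast
  \<comment> \<open>The closed ball of radius \<open>r\<close> around \<open>\<theta>0\<close> lies in the parameter space, as \<open>Lmap\<close> is an isometry.\<close>
  define r where "r = min e (c / 2)"
  have r: "0 < r" "r \<le> e" "r < c" using e c(1) by (auto simp: r_def min_def)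
  have Th: "Lmap A \<theta> \<in> Lplus F" if "dist \<theta> \<theta>0 \<le> r" for \<theta>
    using that r(3) by (intro Lplus LS) (simp add: dist_Lmap[OF A] flip: \<theta>0)
  define f where "f \<theta> = conjugate F (Lmap A \<theta>)" for \<theta>
  define g :: "real^'m^'m \<Rightarrow> real^'d" where "g S = (\<chi> i. A i \<bullet> S)" for S
  define a where "a = Lmap A \<theta>0 \<bullet> X - real_of_ereal (F X)"
  have conv: "ereal_convex_on UNIV f"
    unfolding f_def by (rule ereal_convex_on_conjugate_Lmap[OF F AS])
  have fin: "\<bar>f \<theta>\<bar> \<noteq> \<infinity>" if "\<theta> \<in> UNIV \<inter> cball \<theta>0 r" for \<theta>
    unfolding f_def by (rule conjugate_finite_on_Lplus[OF F Th]) (use that in \<open>simp add: dist_commute\<close>)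
  have cont: "continuous_on (UNIV \<inter> cball \<theta>0 r) (\<lambda>\<theta>. real_of_ereal (f \<theta>))"
    unfolding f_def
    by (rule continuous_on_compose2[OF continuous_on_conjugate[OF F] linear_continuous_on])
       (auto simp: dist_commute linear_conv_bounded_linear[symmetric] linear_Lmap intro!: Th)
  have a: "f \<theta>0 = ereal a"
    unfolding f_def a_def \<theta>0 by (rule conjugate_at_gradient[OF F X])
  have tangent: "ereal (a + g X \<bullet> (\<theta> - \<theta>0)) < f \<theta>" if "\<theta> \<in> UNIV" "\<theta> \<noteq> \<theta>0" for \<theta>
  proof (rule ccontr)
    assume *: "\<not> ?thesis"
    have "g X \<bullet> (\<theta> - \<theta>0) = Lmap A (\<theta> - \<theta>0) \<bullet> X"
      unfolding Lmap_inner g_def by (rule inner_commute)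
    then have "a + g X \<bullet> (\<theta> - \<theta>0) = Lmap A \<theta> \<bullet> X - real_of_ereal (F X)"
      by (simp add: a_def linear_diff[OF linear_Lmap] inner_diff_left)
    with * have "conjugate F (Lmap A \<theta>) \<le> ereal (Lmap A \<theta> \<bullet> X - real_of_ereal (F X))"
      by (simp add: f_def not_less)
    then have "Lmap A \<theta> = Lmap A \<theta>0"
      unfolding \<theta>0 by (rule sym_grad_if_conjugate_le[OF F X LS])
    then have "dist \<theta> \<theta>0 = 0" using dist_Lmap[OF A, of \<theta> \<theta>0] by simp
    with that show False by simp
  qed
  show thesis
  proof (rule convex_tilt_minimizer[OF subspace_UNIV UNIV_I conv r(1) fin cont a tangent])
    fix \<delta> assume \<delta>: "0 < \<delta>"
      and far: "\<And>s \<theta>. norm s < \<delta> \<Longrightarrow> \<theta> \<in> UNIV \<Longrightarrow> r \<le> dist \<theta> \<theta>0 \<Longrightarrow>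
           ereal (a + (g X + s) \<bullet> (\<theta> - \<theta>0)) < f \<theta>"
      and near: "\<And>s. norm s < \<delta> \<Longrightarrow>
           \<exists>z b. z \<in> UNIV \<and> dist z \<theta>0 < r \<and> f z = ereal b \<and>
             (\<forall>\<theta>\<in>UNIV. ereal (b + (g X + s) \<bullet> (\<theta> - z)) \<le> f \<theta>)"
    have loss: "bregman_loss F A S \<theta> = f \<theta> - ereal (g S \<bullet> \<theta>)" for S \<theta>
      unfolding f_def g_def by (rule bregman_loss_eq[OF AS])
    have gS: "norm (g S - g X) < \<delta>" if "norm (S - X) < \<delta>" for S
    proof -
      have "g S - g X = (\<chi> i. A i \<bullet> (S - X))" by (simp add: g_def vec_eq_iff inner_diff_right)
      then show ?thesis using norm_coordinates_le[OF A, of "S - X"] that by simp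
    qed
    show thesis
    proof (rule that[OF \<delta>])
      fix S :: "real^'m^'m" assume S: "norm (S - X) < \<delta>"
      obtain z b where z: "dist z \<theta>0 < r" "f z = ereal b"
        "\<And>\<theta>. ereal (b + g S \<bullet> (\<theta> - z)) \<le> f \<theta>"
        using near[OF gS[OF S]] by auto
      have "z \<in> Theta_plus F A" using Th[of z] z(1) by (simp add: Theta_plus_def)
      moreover have "\<not> bregman_loss F A S \<theta> < bregman_loss F A S z" for \<theta>
        using z(3)[of \<theta>] by (cases "f \<theta>") (auto simp: loss z(2) inner_diff_right)
      ultimately show "\<exists>\<theta>. bregman_minimizer F A S \<theta>"
        unfolding bregman_minimizer_def is_arg_min_def by blast
    next
      fix S :: "real^'m^'m" and \<theta> assume S: "norm (S - X) < \<delta>" and \<theta>: "bregman_minimizer F A S \<theta>"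
      have "\<theta>0 \<in> Theta_plus F A" using Th[of \<theta>0] r(1) by (simp add: Theta_plus_def)
      then have "\<not> bregman_loss F A S \<theta>0 < bregman_loss F A S \<theta>"
        using \<theta> by (simp add: bregman_minimizer_def is_arg_min_def)
      moreover have "bregman_loss F A S \<theta>0 < bregman_loss F A S \<theta>" if "r \<le> dist \<theta> \<theta>0"
        using far[OF gS[OF S] UNIV_I that]
        by (cases "f \<theta>") (auto simp: loss a inner_diff_right)
      ultimately have "dist \<theta> \<theta>0 < r" by force
      then show "dist \<theta> \<theta>0 < e" using r(2) by simp
    qed
  qed
qed

section \<open>The weak law of large numbers\<close>

lemma truncation_L1_approx:
  fixes \<mu> :: "real measure"
  assumes int: "integrable \<mu> (\<lambda>x. x)" and e: "0 < e"
  obtains b where "0 < b" "(\<integral>x. \<bar>x - x * indicator {-b..b} x\<bar> \<partial>\<mu>) < e"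
proof -
  have [measurable]: "(\<lambda>x. x) \<in> borel_measurable \<mu>" using int by auto
  have ind[measurable]: "(\<lambda>x. indicator {-b..b} x :: real) \<in> borel_measurable \<mu>" for b :: real
    using measurable_compose[of "\<lambda>x. x" \<mu> borel "indicator {-b..b}" borel] by simp
  define h where "h n x = \<bar>x - x * indicator {- real n..real n} x\<bar>" for n x
  have "(\<lambda>n. \<integral>x. h n x \<partial>\<mu>) \<longlonglongrightarrow> (\<integral>x. 0 \<partial>\<mu>)"
  proof (rule integral_dominated_convergence[where w = "\<lambda>x. \<bar>x\<bar>"])
    show "AE x in \<mu>. (\<lambda>n. h n x) \<longlonglongrightarrow> 0"
    proof (rule AE_I2)
      fix x
      have "\<forall>\<^sub>F n in sequentially. h n x = 0"
        using eventually_ge_at_top[of "nat \<lceil>\<bar>x\<bar>\<rceil>"]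
      proof eventually_elim
        case (elim n)
        then have "\<bar>x\<bar> \<le> real n" by linarith
        then show ?case by (auto simp: h_def indicator_def)
      qed
      then show "(\<lambda>n. h n x) \<longlonglongrightarrow> 0" by (rule tendsto_eventually)
    qed
    show "AE x in \<mu>. norm (h n x) \<le> \<bar>x\<bar>" for n by (rule AE_I2) (simp add: h_def indicator_def)
    show "h n \<in> borel_measurable \<mu>" for n unfolding h_def by measurable
    show "integrable \<mu> (\<lambda>x. \<bar>x\<bar>)" using int by (rule integrable_abs)
  qed simp
  then have "\<forall>\<^sub>F n in sequentially. (\<integral>x. h n x \<partial>\<mu>) < e"
    by (rule order_tendstoD(2)) (simp add: e)
  then have "\<forall>\<^sub>F n in sequentially. (\<integral>x. h n x \<partial>\<mu>) < e \<and> 0 < n"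
    using eventually_gt_at_top by (rule eventually_conj)
  then obtain n where "(\<integral>x. h n x \<partial>\<mu>) < e" "0 < n"
    by (auto simp: eventually_sequentially)
  with that[of "real n"] show thesis by (simp add: h_def)
qed

context prob_space begin

lemma expectation_square_sum_indep_le:
  fixes W :: "nat \<Rightarrow> 'a \<Rightarrow> real"
  assumes indep: "indep_vars (\<lambda>_. borel) W I" and I: "finite I"
    and mean: "\<And>i. i \<in> I \<Longrightarrow> expectation (W i) = 0"
    and bound: "\<And>i \<omega>. i \<in> I \<Longrightarrow> \<bar>W i \<omega>\<bar> \<le> k"
  shows "integrable M (\<lambda>\<omega>. (\<Sum>i\<in>I. W i \<omega>)\<^sup>2)"
    and "expectation (\<lambda>\<omega>. (\<Sum>i\<in>I. W i \<omega>)\<^sup>2) \<le> real (card I) * k\<^sup>2"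
proof -
  have meas[measurable]: "W i \<in> borel_measurable M" if "i \<in> I" for i
    using indep that by (simp add: indep_vars_def2)
  have int: "integrable M (W i)" if "i \<in> I" for i
    using bound[OF that] meas[OF that] by (intro integrable_const_bound[of _ k]) auto
  have k: "W i \<omega> * W j \<omega> \<le> k\<^sup>2" "\<bar>W i \<omega> * W j \<omega>\<bar> \<le> k\<^sup>2" if "i \<in> I" "j \<in> I" for i j \<omega>
  proof -
    show "\<bar>W i \<omega> * W j \<omega>\<bar> \<le> k\<^sup>2"
      unfolding abs_mult power2_eq_square using bound[OF that(1), of \<omega>] bound[OF that(2), of \<omega>]
      by (intro mult_mono) auto
    then show "W i \<omega> * W j \<omega> \<le> k\<^sup>2" by simp
  qed
  have int2: "integrable M (\<lambda>\<omega>. W i \<omega> * W j \<omega>)" if "i \<in> I" "j \<in> I" for i j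
    using k(2)[OF that] meas[OF that(1)] meas[OF that(2)] by (intro integrable_const_bound[of _ "k\<^sup>2"]) auto
  have sq: "(\<Sum>i\<in>I. W i \<omega>)\<^sup>2 = (\<Sum>i\<in>I. \<Sum>j\<in>I. W i \<omega> * W j \<omega>)" for \<omega>
    by (simp add: power2_eq_square sum_product)
  show "integrable M (\<lambda>\<omega>. (\<Sum>i\<in>I. W i \<omega>)\<^sup>2)"
    unfolding sq by (intro Bochner_Integration.integrable_sum int2)
  have off: "expectation (\<lambda>\<omega>. W i \<omega> * W j \<omega>) = 0" if ij: "i \<in> I" "j \<in> I" "i \<noteq> j" for i j
  proof -
    have "expectation (\<lambda>\<omega>. \<Prod>l\<in>{i, j}. W l \<omega>) = (\<Prod>l\<in>{i, j}. expectation (W l))"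
      using ij by (intro indep_vars_lebesgue_integral indep_vars_subset[OF indep]) (auto intro: int)
    then show ?thesis using ij mean by simp
  qed
  have "expectation (\<lambda>\<omega>. (\<Sum>i\<in>I. W i \<omega>)\<^sup>2) = (\<Sum>i\<in>I. \<Sum>j\<in>I. expectation (\<lambda>\<omega>. W i \<omega> * W j \<omega>))"
    unfolding sq by (simp add: Bochner_Integration.integral_sum int2 Bochner_Integration.integrable_sum)
  also have "\<dots> = (\<Sum>i\<in>I. expectation (\<lambda>\<omega>. W i \<omega> * W i \<omega>))"
  proof (rule sum.cong)
    fix i assume i: "i \<in> I"
    have "(\<Sum>j\<in>I. expectation (\<lambda>\<omega>. W i \<omega> * W j \<omega>))
        = (\<Sum>j\<in>I. if j = i then expectation (\<lambda>\<omega>. W i \<omega> * W i \<omega>) else 0)"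
      using off i by (intro sum.cong) auto
    then show "(\<Sum>j\<in>I. expectation (\<lambda>\<omega>. W i \<omega> * W j \<omega>)) = expectation (\<lambda>\<omega>. W i \<omega> * W i \<omega>)"
      using i I by simp
  qed simp
  also have "\<dots> \<le> (\<Sum>i\<in>I. k\<^sup>2)"
    by (intro sum_mono integral_le_const int2 AE_I2 k) auto
  finally show "expectation (\<lambda>\<omega>. (\<Sum>i\<in>I. W i \<omega>)\<^sup>2) \<le> real (card I) * k\<^sup>2" by simp
qed

text \<open>
  The truncated and centred variables have an average of second moment \<open>O(1/n)\<close>; the remainders
  and the shift of the mean are small in \<open>L\<^sup>1\<close>, uniformly in \<open>n\<close>.
\<close>
lemma weak_law_of_large_numbers_L1:
  fixes Z :: "nat \<Rightarrow> 'a \<Rightarrow> real"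
  assumes indep: "indep_vars (\<lambda>_. borel) Z {1..}"
    and distr: "\<And>i. i \<ge> 1 \<Longrightarrow> distr M borel (Z i) = \<mu>"
    and int: "integrable \<mu> (\<lambda>x. x)"
  shows "(\<lambda>n. expectation (\<lambda>\<omega>. \<bar>(\<Sum>i=1..n. Z i \<omega>) / real n - (\<integral>x. x \<partial>\<mu>)\<bar>)) \<longlonglongrightarrow> 0"
proof (rule LIMSEQ_I)
  fix r :: real assume r: "0 < r"
  define e where "e = r / 5"
  have e: "0 < e" using r by (simp add: e_def)
  obtain b where b: "0 < b" "(\<integral>x. \<bar>x - x * indicator {-b..b} x\<bar> \<partial>\<mu>) < e"
    using truncation_L1_approx[OF int e] by metis
  define T :: "real \<Rightarrow> real" where "T x = x * indicator {-b..b} x" for x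
  have [measurable]: "T \<in> borel_measurable borel" unfolding T_def by measurable
  have Tb: "\<bar>T x\<bar> \<le> b" for x using b(1) by (auto simp: T_def indicator_def)
  have meas[measurable]: "Z i \<in> borel_measurable M" if "i \<ge> 1" for i
    using indep that by (simp add: indep_vars_def2)
  have \<mu>: "prob_space \<mu>" "sets \<mu> = sets borel"
    using prob_space_distr[OF meas[of 1]] distr[of 1] by auto
  interpret \<mu>: prob_space \<mu> by (rule \<mu>(1))
  note [measurable_cong] = \<mu>(2)
  have intT: "integrable \<mu> T"
    by (rule \<mu>.integrable_const_bound[of _ b]) (auto simp: Tb)
  have law: "expectation (\<lambda>\<omega>. h (Z i \<omega>)) = (\<integral>x. h x \<partial>\<mu>)"
      and law_int: "integrable M (\<lambda>\<omega>. h (Z i \<omega>)) \<longleftrightarrow> integrable \<mu> h"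
    if "i \<ge> 1" "h \<in> borel_measurable borel" for i and h :: "real \<Rightarrow> real"
    using integral_distr[OF meas[OF that(1)] that(2)] integrable_distr_eq[OF meas[OF that(1)] that(2)]
    by (simp_all add: distr[OF that(1)])
  define m where "m = (\<integral>x. x \<partial>\<mu>)"
  define mT where "mT = (\<integral>x. T x \<partial>\<mu>)"
  define W where "W i \<omega> = T (Z i \<omega>) - mT" for i \<omega>
  have mTb: "\<bar>mT\<bar> \<le> b"
  proof -
    have "norm mT \<le> (\<integral>x. norm (T x) \<partial>\<mu>)" unfolding mT_def by (rule integral_norm_bound)
    also have "\<dots> \<le> b" using intT by (intro \<mu>.integral_le_const) (auto simp: Tb)
    finally show ?thesis by simp
  qed
  have rest: "(\<integral>x. \<bar>x - T x\<bar> \<partial>\<mu>) < e" using b(2) by (simp add: T_def)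
  have mm: "\<bar>mT - m\<bar> < e"
  proof -
    have "norm (\<integral>x. T x - x \<partial>\<mu>) \<le> (\<integral>x. norm (T x - x) \<partial>\<mu>)" by (rule integral_norm_bound)
    then show ?thesis using rest intT int by (simp add: m_def mT_def abs_minus_commute)
  qed
  have W_indep: "indep_vars (\<lambda>_. borel) W {1..n}" for n
    unfolding W_def by (intro indep_vars_compose2[where Y = "\<lambda>_ x. T x - mT", OF indep_vars_subset[OF indep]]) auto
  have W_mean: "expectation (W i) = 0" if "i \<ge> 1" for i
    using that law[of i "\<lambda>x. T x - mT"] intT by (simp add: W_def[abs_def] mT_def \<mu>.prob_space)
  have W_bound: "\<bar>W i \<omega>\<bar> \<le> 2 * b" for i \<omega>
    using Tb[of "Z i \<omega>"] mTb by (simp add: W_def)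
  have key: "expectation (\<lambda>\<omega>. \<bar>(\<Sum>i=1..n. Z i \<omega>) / real n - m\<bar>) \<le> 3 * e + b\<^sup>2 / (e * real n)"
    if n: "n \<ge> 1" for n
  proof -
    define Q where "Q \<omega> = (\<Sum>i=1..n. W i \<omega>)" for \<omega>
    have W_mean': "expectation (W i) = 0" if "i \<in> {1..n}" for i
      using that by (intro W_mean) simp
    have Q: "integrable M (\<lambda>\<omega>. (Q \<omega>)\<^sup>2)" "expectation (\<lambda>\<omega>. (Q \<omega>)\<^sup>2) \<le> real n * (2 * b)\<^sup>2"
      using expectation_square_sum_indep_le[OF W_indep[of n] finite_atLeastAtMost W_mean' W_bound]
      unfolding Q_def by simp_all
    have Zint: "integrable M (\<lambda>\<omega>. \<bar>Z i \<omega> - T (Z i \<omega>)\<bar>)" if "i \<in> {1..n}" for i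
    proof (subst law_int[of i "\<lambda>x. \<bar>x - T x\<bar>"])
      show "integrable \<mu> (\<lambda>x. \<bar>x - T x\<bar>)"
        by (intro integrable_abs Bochner_Integration.integrable_diff int intT)
    qed (use that in auto)
    \<comment> \<open>The three error terms: the centred average by \<open>\<bar>q\<bar> \<le> e + q\<^sup>2 / (4 e)\<close>, the remainders, and the
        shift of the mean.\<close>
    define g where "g \<omega> = (e + (Q \<omega>)\<^sup>2 / (4 * e * (real n)\<^sup>2))
        + (\<Sum>i=1..n. \<bar>Z i \<omega> - T (Z i \<omega>)\<bar>) / real n + e" for \<omega>
    have g_int: "integrable M g"
      unfolding g_def
      by (intro Bochner_Integration.integrable_add Bochner_Integration.integrable_divide
          Bochner_Integration.integrable_sum integrable_const Q(1) Zint)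
    have le_g: "\<bar>(\<Sum>i=1..n. Z i \<omega>) / real n - m\<bar> \<le> g \<omega>" for \<omega>
    proof -
      define q where "q = Q \<omega> / real n"
      have "(\<Sum>i=1..n. Z i \<omega>) = Q \<omega> + real n * mT + (\<Sum>i=1..n. Z i \<omega> - T (Z i \<omega>))"
        by (simp add: Q_def W_def sum_subtractf)
      then have "(\<Sum>i=1..n. Z i \<omega>) / real n - m
          = q + (\<Sum>i=1..n. Z i \<omega> - T (Z i \<omega>)) / real n + (mT - m)"
        using n by (simp add: q_def field_simps)
      moreover have "\<bar>(\<Sum>i=1..n. Z i \<omega> - T (Z i \<omega>)) / real n\<bar>
          \<le> (\<Sum>i=1..n. \<bar>Z i \<omega> - T (Z i \<omega>)\<bar>) / real n"
        using n sum_abs[of "\<lambda>i. Z i \<omega> - T (Z i \<omega>)" "{1..n}"] by (simp add: divide_right_mono)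
      moreover have "\<bar>q\<bar> \<le> e + q\<^sup>2 / (4 * e)"
      proof -
        have "0 \<le> (\<bar>q\<bar> - 2 * e)\<^sup>2" by simp
        then have "\<bar>q\<bar> * (4 * e) \<le> q\<^sup>2 + 4 * e\<^sup>2" by (simp add: power2_diff)
        then show ?thesis using e by (simp add: field_simps power2_eq_square)
      qed
      moreover have "q\<^sup>2 / (4 * e) = (Q \<omega>)\<^sup>2 / (4 * e * (real n)\<^sup>2)" by (simp add: q_def power_divide)
      ultimately show ?thesis unfolding g_def using mm by linarith
    qed
    have "expectation (\<lambda>\<omega>. \<bar>(\<Sum>i=1..n. Z i \<omega>) / real n - m\<bar>) \<le> expectation g"
      using g_int le_g order_trans[OF abs_ge_zero le_g] by (rule integral_mono')
    also have "expectation g = e + expectation (\<lambda>\<omega>. (Q \<omega>)\<^sup>2) / (4 * e * (real n)\<^sup>2)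
        + expectation (\<lambda>\<omega>. \<Sum>i=1..n. \<bar>Z i \<omega> - T (Z i \<omega>)\<bar>) / real n + e"
      unfolding g_def
      by (subst Bochner_Integration.integral_add Bochner_Integration.integral_divide |
          intro Bochner_Integration.integrable_add Bochner_Integration.integrable_divide
            Bochner_Integration.integrable_sum integrable_const Q(1) Zint |
          simp add: prob_space)+
    also have "expectation (\<lambda>\<omega>. \<Sum>i=1..n. \<bar>Z i \<omega> - T (Z i \<omega>)\<bar>)
        = (\<Sum>i=1..n. expectation (\<lambda>\<omega>. \<bar>Z i \<omega> - T (Z i \<omega>)\<bar>))"
      by (rule Bochner_Integration.integral_sum) (rule Zint)
    also have "(\<Sum>i=1..n. expectation (\<lambda>\<omega>. \<bar>Z i \<omega> - T (Z i \<omega>)\<bar>)) = (\<Sum>i=1..n. \<integral>x. \<bar>x - T x\<bar> \<partial>\<mu>)"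
      by (intro sum.cong law[of _ "\<lambda>x. \<bar>x - T x\<bar>"]) auto
    also have "\<dots> / real n \<le> e" using rest n by simp
    also have "expectation (\<lambda>\<omega>. (Q \<omega>)\<^sup>2) / (4 * e * (real n)\<^sup>2) \<le> real n * (2 * b)\<^sup>2 / (4 * e * (real n)\<^sup>2)"
      using Q(2) e by (intro divide_right_mono) auto
    also have "\<dots> = b\<^sup>2 / (e * real n)" using n e by (simp add: power2_eq_square field_simps)
    finally show ?thesis by simp
  qed
  have "(\<lambda>n. b\<^sup>2 / (e * real n)) \<longlonglongrightarrow> 0"
    using lim_const_over_n[of "b\<^sup>2 / e"] by simp
  then have "\<forall>\<^sub>F n in sequentially. b\<^sup>2 / (e * real n) < e" by (rule order_tendstoD(2)) (rule e)
  then have "\<forall>\<^sub>F n in sequentially. norm (expectation (\<lambda>\<omega>. \<bar>(\<Sum>i=1..n. Z i \<omega>) / real n - m\<bar>) - 0) < r"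
    using eventually_ge_at_top[of 1]
  proof eventually_elim
    case (elim n)
    have "0 \<le> expectation (\<lambda>\<omega>. \<bar>(\<Sum>i=1..n. Z i \<omega>) / real n - m\<bar>)" by simp
    then show ?case using key[OF elim(2)] elim(1) r unfolding e_def by simp
  qed
  then show "\<exists>no. \<forall>n\<ge>no. norm (expectation (\<lambda>\<omega>. \<bar>(\<Sum>i=1..n. Z i \<omega>) / real n - (\<integral>x. x \<partial>\<mu>)\<bar>) - 0) < r"
    unfolding eventually_sequentially m_def .
qed

end

section \<open>Convergence of the sample covariance and of the estimator\<close>

lemma norm_matrix_le_sum: "norm (B :: real^'n^'m) \<le> (\<Sum>j\<in>UNIV. \<Sum>k\<in>UNIV. \<bar>B $ j $ k\<bar>)"
proof -
  have "norm B \<le> (\<Sum>j\<in>UNIV. norm (B $ j))" unfolding norm_vec_def by (rule L2_set_le_sum) simp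
  also have "\<dots> \<le> (\<Sum>j\<in>UNIV. \<Sum>k\<in>UNIV. \<bar>B $ j $ k\<bar>)" by (intro sum_mono norm_le_l1_cart)
  finally show ?thesis .
qed

lemma bounded_linear_entry: "bounded_linear (\<lambda>B :: real^'n^'m. B $ j $ k)"
  by (rule bounded_linear_compose[OF bounded_linear_vec_nth bounded_linear_vec_nth])

lemma borel_measurable_outer [measurable]:
  "(\<lambda>x :: real^'m. outer x x) \<in> borel_measurable borel"
proof -
  have "continuous_on UNIV (\<lambda>x :: real^'m. outer x x)"
    unfolding outer_def by (intro continuous_intros)
  then show ?thesis by (rule borel_measurable_continuous_onI)
qed

context prob_space begin

text \<open>The entries of \<open>X\<^sub>i X\<^sub>i\<^sup>T\<close> are integrable, so the law of large numbers applies entrywise.\<close>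
lemma sample_cov_L1:
  fixes X :: "nat \<Rightarrow> 'a \<Rightarrow> real^'m"
  assumes indep: "indep_vars (\<lambda>_. borel) X {1..}"
    and distr: "\<And>i. i \<ge> 1 \<Longrightarrow> distr M borel (X i) = D"
    and int: "integrable D (\<lambda>x. (norm x)\<^sup>2)"
  shows "\<And>n. integrable M (\<lambda>\<omega>. norm (sample_cov X n \<omega> - (\<integral>x. outer x x \<partial>D)))"
    and "(\<lambda>n. expectation (\<lambda>\<omega>. norm (sample_cov X n \<omega> - (\<integral>x. outer x x \<partial>D)))) \<longlonglongrightarrow> 0"
proof -
  define C where "C = (\<integral>x. outer x x \<partial>D)"
  have meas[measurable]: "X i \<in> borel_measurable M" if "i \<ge> 1" for i
    using indep that by (simp add: indep_vars_def2)
  have D: "sets D = sets borel" using distr[of 1] by auto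
  note [measurable_cong] = D
  have intD: "integrable D (\<lambda>x. outer x x)"
    by (rule Bochner_Integration.integrable_bound[OF int]) (auto simp: norm_outer power2_eq_square)
  have intX: "integrable M (\<lambda>\<omega>. outer (X i \<omega>) (X i \<omega>))" if "i \<ge> 1" for i
    using integrable_distr_eq[OF meas[OF that] borel_measurable_outer] intD by (simp add: distr[OF that])
  have intS: "integrable M (\<lambda>\<omega>. sample_cov X n \<omega> - C)" for n
    unfolding sample_cov_def
    by (intro Bochner_Integration.integrable_diff integrable_scaleR_right
        Bochner_Integration.integrable_sum intX integrable_const) auto
  show intN: "integrable M (\<lambda>\<omega>. norm (sample_cov X n \<omega> - (\<integral>x. outer x x \<partial>D)))" for n
    using integrable_norm[OF intS[of n]] by (simp add: C_def)
  have entry: "(\<lambda>n. expectation (\<lambda>\<omega>. \<bar>(sample_cov X n \<omega> - C) $ j $ k\<bar>)) \<longlonglongrightarrow> 0" for j k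
  proof -
    define h where "h x = x $ j * x $ k" for x :: "real^'m"
    have h: "h x = outer x x $ j $ k" for x by (simp add: h_def outer_def)
    have hm[measurable]: "h \<in> borel_measurable borel"
      unfolding h_def by (intro borel_measurable_continuous_onI continuous_intros)
    have hm': "h \<in> measurable D borel" by measurable
    have indep_h: "indep_vars (\<lambda>_. borel) (\<lambda>i \<omega>. h (X i \<omega>)) {1..}"
      by (rule indep_vars_compose2[OF indep]) simp
    have distr_h: "distr M borel (\<lambda>\<omega>. h (X i \<omega>)) = distr D borel h" if "i \<ge> 1" for i
      using distr_distr[OF hm meas[OF that]] by (simp add: distr[OF that] comp_def)
    have int_h: "integrable D h"
      unfolding h by (rule integrable_bounded_linear[OF bounded_linear_entry intD])
    have "integrable (distr D borel h) (\<lambda>x. x)"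
      using int_h by (subst integrable_distr_eq[OF hm']) auto
    from weak_law_of_large_numbers_L1[OF indep_h distr_h this]
    have "(\<lambda>n. expectation (\<lambda>\<omega>. \<bar>(\<Sum>i=1..n. h (X i \<omega>)) / real n - (\<integral>x. x \<partial>distr D borel h)\<bar>)) \<longlonglongrightarrow> 0" .
    moreover have "(\<integral>x. x \<partial>distr D borel h) = C $ j $ k"
    proof -
      have "(\<integral>x. x \<partial>distr D borel h) = (\<integral>x. h x \<partial>D)" by (rule integral_distr[OF hm']) simp
      also have "\<dots> = C $ j $ k"
        unfolding h C_def by (rule integral_bounded_linear[OF bounded_linear_entry intD])
      finally show ?thesis .
    qed
    moreover have "(\<Sum>i=1..n. h (X i \<omega>)) / real n = sample_cov X n \<omega> $ j $ k" for n \<omega>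
      by (simp add: sample_cov_def h)
    ultimately show ?thesis by simp
  qed
  have int_entry: "integrable M (\<lambda>\<omega>. \<bar>(sample_cov X n \<omega> - C) $ j $ k\<bar>)" for n j k
    by (intro integrable_abs integrable_bounded_linear[OF bounded_linear_entry intS])
  have lim: "(\<lambda>n. \<Sum>j\<in>UNIV. \<Sum>k\<in>UNIV. expectation (\<lambda>\<omega>. \<bar>(sample_cov X n \<omega> - C) $ j $ k\<bar>)) \<longlonglongrightarrow> 0"
    by (intro tendsto_null_sum entry)
  have le: "expectation (\<lambda>\<omega>. norm (sample_cov X n \<omega> - C))
      \<le> (\<Sum>j\<in>UNIV. \<Sum>k\<in>UNIV. expectation (\<lambda>\<omega>. \<bar>(sample_cov X n \<omega> - C) $ j $ k\<bar>))" for n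
  proof -
    have "expectation (\<lambda>\<omega>. norm (sample_cov X n \<omega> - C))
        \<le> expectation (\<lambda>\<omega>. \<Sum>j\<in>UNIV. \<Sum>k\<in>UNIV. \<bar>(sample_cov X n \<omega> - C) $ j $ k\<bar>)"
      by (intro integral_mono integrable_norm intS Bochner_Integration.integrable_sum int_entry
          norm_matrix_le_sum)
    also have "\<dots> = (\<Sum>j\<in>UNIV. \<Sum>k\<in>UNIV. expectation (\<lambda>\<omega>. \<bar>(sample_cov X n \<omega> - C) $ j $ k\<bar>))"
      by (subst Bochner_Integration.integral_sum, intro Bochner_Integration.integrable_sum int_entry)
         (intro sum.cong refl Bochner_Integration.integral_sum int_entry)
    finally show ?thesis .
  qed
  show "(\<lambda>n. expectation (\<lambda>\<omega>. norm (sample_cov X n \<omega> - (\<integral>x. outer x x \<partial>D)))) \<longlonglongrightarrow> 0"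
    unfolding C_def[symmetric]
    by (rule tendsto_sandwich[OF always_eventually always_eventually tendsto_const lim])
       (intro allI Bochner_Integration.integral_nonneg norm_ge_zero le)+
qed

text \<open>Markov's inequality for events that need not be measurable.\<close>
lemma outer_measure_tendsto_0_if_L1:
  fixes Y :: "nat \<Rightarrow> 'a \<Rightarrow> real"
  assumes int: "\<And>n. integrable M (Y n)" and nonneg: "\<And>n \<omega>. 0 \<le> Y n \<omega>"
    and lim: "(\<lambda>n. expectation (Y n)) \<longlonglongrightarrow> 0" and d: "0 < \<delta>"
    and sub: "\<And>n. n \<ge> 1 \<Longrightarrow> E n \<subseteq> {\<omega>\<in>space M. \<delta> \<le> Y n \<omega>}"
  shows "(\<lambda>n. outer_measure_of M (E n)) \<longlonglongrightarrow> 0"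
proof -
  have "outer_measure_of M (E n) \<le> ennreal (expectation (Y n) / \<delta>)" if "n \<ge> 1" for n
  proof -
    have [measurable]: "Y n \<in> borel_measurable M" using int by auto
    have "outer_measure_of M (E n) \<le> outer_measure_of M {\<omega>\<in>space M. \<delta> \<le> Y n \<omega>}"
      by (rule outer_measure_of_mono[OF sub[OF that]])
    also have "\<dots> = emeasure M {\<omega>\<in>space M. \<delta> \<le> Y n \<omega>}" by (rule outer_measure_of_eq) measurable
    also have "\<dots> \<le> ennreal (expectation (Y n) / \<delta>)"
      using integral_Markov_inequality[OF int _ d] nonneg by auto
    finally show ?thesis .
  qed
  then have le: "\<forall>\<^sub>F n in sequentially. outer_measure_of M (E n) \<le> ennreal (expectation (Y n) / \<delta>)"
    by (intro eventually_mono[OF eventually_ge_at_top[of 1]])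
  have "(\<lambda>n. ennreal (expectation (Y n) / \<delta>)) \<longlonglongrightarrow> ennreal (0 / \<delta>)"
    using d by (intro tendsto_ennrealI tendsto_divide lim tendsto_const) simp
  then show ?thesis
    using tendsto_sandwich[OF always_eventually le tendsto_const] by simp
qed

end

theorem proposition4p1:
  fixes F :: "real^'m^'m \<Rightarrow> ereal"
    and \<L> :: "(real^'m^'m) set"
    and A :: "'d::finite \<Rightarrow> real^'m^'m"
    and P :: "'a measure"
    and X :: "nat \<Rightarrow> 'a \<Rightarrow> real^'m"
    and D :: "(real^'m) measure"
    and \<Sigma>\<^sub>0 :: "real^'m^'m"
    and est :: "nat \<Rightarrow> 'a \<Rightarrow> real^'d"
  assumes "F \<in> bregman_class"
    and "subspace \<L>" and "\<L> \<subseteq> Sym"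
    and "orthonormal_basis A \<L>"
    and "prob_space P"
    and "prob_space.indep_vars P (\<lambda>_. borel) X {1..}"
    and "\<And>i. i \<ge> 1 \<Longrightarrow> distr P borel (X i) = D"
    and "integrable D (\<lambda>x. x)" and "mean_vec D = 0"
    and "integrable D (\<lambda>x. (norm x)\<^sup>2)" and "cov_mat D = \<Sigma>\<^sub>0" and "\<Sigma>\<^sub>0 \<in> SymPD"
    and "\<And>n. n \<ge> 1 \<Longrightarrow> (\<integral>\<omega>. sample_cov X n \<omega> \<partial>P) = \<Sigma>\<^sub>0"
    and "\<Sigma>\<^sub>0 \<in> bregman_model F \<L>"
    and "is_bregman_estimator F A P X est"
  shows "\<exists>\<theta>\<^sub>0. \<theta>\<^sub>0 \<in> Theta_plus F A \<and>
           (\<forall>\<theta>. has_sym_gradient (conjugate F) \<Sigma>\<^sub>0 (Lmap A \<theta>) \<longleftrightarrow> \<theta> = \<theta>\<^sub>0) \<and>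
           converges_in_prob P est \<theta>\<^sub>0"
proof -
  note F = assms(1) and A = assms(4) assms(3) and PD = assms(12)
  interpret prob_space P by (rule assms(5))
  have "sym_grad F \<Sigma>\<^sub>0 \<in> span (range A)"
    using assms(14) A(1) by (simp add: bregman_model_def orthonormal_basis_def)
  then obtain \<theta>0 where \<theta>0: "Lmap A \<theta>0 = sym_grad F \<Sigma>\<^sub>0"
    using span_subset_range_Lmap[of A] by (metis imageE subsetD)
  have Theta: "\<theta>0 \<in> Theta_plus F A" using PD by (simp add: Theta_plus_def \<theta>0 Lplus_def)
  have grad: "has_sym_gradient (conjugate F) \<Sigma>\<^sub>0 (Lmap A \<theta>) \<longleftrightarrow> \<theta> = \<theta>0" for \<theta>
  proof
    assume "has_sym_gradient (conjugate F) \<Sigma>\<^sub>0 (Lmap A \<theta>)"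
    then have "Lmap A \<theta> = Lmap A \<theta>0" unfolding \<theta>0 by (rule conjugate_gradient_unique[OF F PD])
    then show "\<theta> = \<theta>0" using dist_Lmap[OF A, of \<theta> \<theta>0] by simp
  qed (simp add: \<theta>0 conjugate_has_sym_gradient[OF F PD])
  have cov: "(\<integral>x. outer x x \<partial>D) = \<Sigma>\<^sub>0"
    using assms(11) by (simp add: cov_mat_def assms(9))
  have "converges_in_prob P est \<theta>0"
    unfolding converges_in_prob_def
  proof (intro allI impI)
    fix e :: real assume e: "0 < e"
    obtain \<delta> where \<delta>: "0 < \<delta>"
      "\<And>S. norm (S - \<Sigma>\<^sub>0) < \<delta> \<Longrightarrow> \<exists>\<theta>. bregman_minimizer F A S \<theta>"
      "\<And>S \<theta>. norm (S - \<Sigma>\<^sub>0) < \<delta> \<Longrightarrow> bregman_minimizer F A S \<theta> \<Longrightarrow> dist \<theta> \<theta>0 < e"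
      using bregman_minimizer_near[OF F A PD \<theta>0 e] by metis
    note L1 = sample_cov_L1[OF assms(6,7,10), unfolded cov]
    show "(\<lambda>n. outer_measure_of P {\<omega>\<in>space P. dist (est n \<omega>) \<theta>0 > e}) \<longlonglongrightarrow> 0"
    proof (rule outer_measure_tendsto_0_if_L1[OF L1(1) norm_ge_zero L1(2) \<delta>(1)])
      fix n :: nat assume n: "1 \<le> n"
      show "{\<omega>\<in>space P. dist (est n \<omega>) \<theta>0 > e} \<subseteq> {\<omega>\<in>space P. \<delta> \<le> norm (sample_cov X n \<omega> - \<Sigma>\<^sub>0)}"
      proof (intro subsetI CollectI conjI; clarify)
        fix \<omega> assume \<omega>: "\<omega> \<in> space P" "dist (est n \<omega>) \<theta>0 > e"
        show "\<delta> \<le> norm (sample_cov X n \<omega> - \<Sigma>\<^sub>0)"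
        proof (rule ccontr)
          assume "\<not> ?thesis"
          then have near: "norm (sample_cov X n \<omega> - \<Sigma>\<^sub>0) < \<delta>" by simp
          have "bregman_minimizer F A (sample_cov X n \<omega>) (est n \<omega>)"
            using assms(15) n \<omega>(1) \<delta>(2)[OF near] unfolding is_bregman_estimator_def by blast
          from \<delta>(3)[OF near this] show False using \<omega>(2) by simp
        qed
      qed
    qed
  qed
  with Theta grad show ?thesis by blast
qed

end
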